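(* Let $k\geq 1$ be an integer, $\rho>0$, $\kappa=-1/\rho^2$, and $p>0$. For $\lambda\in\mathbb{C}$ let $\varphi_\lambda$ denote the unique radial eigenfunction of the hyperbolic Laplacian on the $(k+1)$-dimensional hyperbolic space of constant sectional curvature $\kappa$ with eigenvalue $\lambda$ and $\varphi_\lambda(0)=1$. Let $$\Omega(p)=\left\{\varphi_\mu \;\middle|\; \mu\in\mathbb{C},\ \varphi_\mu(0)=1\ \text{and}\ \Re\mu\leq-\kappa\left(p^2+\frac{k^2}{4}\right)+\frac{(\Im\mu)^2}{4\kappa p^2}\right\}.$$ Let $r_0\in(0,\pi\rho/(2p)]$. Then the value at $r_0$ determines a radial eigenfunction in $\Omega(p)$ uniquely: if $\varphi_\mu,\varphi_{\mu'}\in\Omega(p)$ and $\varphi_\mu(r_0)=\varphi_{\mu'}(r_0)$, then $\mu=\mu'$ and $\varphi_\mu(r)=\varphi_{\mu'}(r)$ for all $r\geq 0$. Meanwhile, for every $\varphi_\mu\in\Omega(p)$ there are infinitely many radial eigenfunctions $\varphi_\nu\notin\Omega(p)$ (with $\nu\in\mathbb{C}$ and $\varphi_\nu(0)=1$) such that $\varphi_\nu(r_0)=\varphi_\mu(r_0)$.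
   Context: The variable $r$ is the hyperbolic distance to the origin. A radial eigenfunction with eigenvalue $\lambda\in\mathbb{C}$ is a complex-valued twice continuously differentiable function on the hyperbolic space depending only on $r$, regarded as a function $\varphi:[0,\infty)\to\mathbb{C}$ (in particular continuous at $r=0$), satisfying $\varphi''(r)+\frac{k}{\rho}\coth\left(\frac{r}{\rho}\right)\varphi'(r)+\lambda\varphi(r)=0$ for $r>0$. For each $\lambda\in\mathbb{C}$ there is exactly one such function with $\varphi(0)=1$. *)

theory Defs
  imports "HOL-Analysis.Analysis"
begin

text \<open>
  Hyperbolic space of constant sectional curvature \<open>-1/\<rho>\<^sup>2\<close> is modelled by the Poincare ball
  \<open>ball 0 \<rho>\<close> in a Euclidean space \<open>'a\<close> (whose dimension is that of the hyperbolic space), with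
  metric \<open>4 \<rho>\<^sup>4 |dx|\<^sup>2 / (\<rho>\<^sup>2 - |x|\<^sup>2)\<^sup>2\<close>. The model is a single smooth chart, so a function on hyperbolic
  space is twice continuously differentiable iff it is so on the Euclidean ball.
\<close>

definition hyp_dist :: "real \<Rightarrow> 'a::euclidean_space \<Rightarrow> 'a \<Rightarrow> real" where
  "hyp_dist \<rho> x y =
     \<rho> * arcosh (1 + 2 * \<rho>\<^sup>2 * (dist x y)\<^sup>2 / ((\<rho>\<^sup>2 - (norm x)\<^sup>2) * (\<rho>\<^sup>2 - (norm y)\<^sup>2)))"

definition twice_cont_diff_on :: "('a::real_normed_vector \<Rightarrow> 'b::real_normed_vector) \<Rightarrow> 'a set \<Rightarrow> bool"
  (infix "twice'_cont'_diff'_on" 50) where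
  "f twice_cont_diff_on S \<longleftrightarrow>
     (\<exists>(f' :: 'a \<Rightarrow> 'a \<Rightarrow>\<^sub>L 'b) (f'' :: 'a \<Rightarrow> 'a \<Rightarrow>\<^sub>L 'a \<Rightarrow>\<^sub>L 'b).
        (\<forall>x\<in>S. (f has_derivative blinfun_apply (f' x)) (at x within S)) \<and>
        (\<forall>x\<in>S. (f' has_derivative blinfun_apply (f'' x)) (at x within S)) \<and>
        continuous_on S f'')"

text \<open>
  A radial function is given by its profile \<open>\<phi>\<close> on \<open>[0, \<infinity>)\<close>; membership in \<open>extensional {0..}\<close> makes
  the meaningless values at negative arguments canonical, so that equality of profiles is equality
  on \<open>[0, \<infinity>)\<close>. The regularity condition concerns the function on the hyperbolic
  space, including its origin. The type argument supplies the \<open>(k+1)\<close>-dimensional Euclidean space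
  carrying the ball model.
\<close>

definition radial_eigenfunction ::
  "'a::euclidean_space itself \<Rightarrow> nat \<Rightarrow> real \<Rightarrow> complex \<Rightarrow> (real \<Rightarrow> complex) \<Rightarrow> bool" where
  "radial_eigenfunction T k \<rho> \<mu> \<phi> \<longleftrightarrow>
     \<phi> \<in> extensional {0..} \<and>
     (\<lambda>x::'a. \<phi> (hyp_dist \<rho> 0 x)) twice_cont_diff_on ball 0 \<rho> \<and>
     (\<exists>\<phi>' \<phi>''. \<forall>r>0.
        (\<phi> has_vector_derivative \<phi>' r) (at r) \<and>
        (\<phi>' has_vector_derivative \<phi>'' r) (at r) \<and>
        \<phi>'' r + of_real (real k / \<rho> * (cosh (r / \<rho>) / sinh (r / \<rho>))) * \<phi>' r + \<mu> * \<phi> r = 0)"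

definition phi ::
  "'a::euclidean_space itself \<Rightarrow> nat \<Rightarrow> real \<Rightarrow> complex \<Rightarrow> real \<Rightarrow> complex" where
  "phi T k \<rho> \<mu> = (THE \<phi>. radial_eigenfunction T k \<rho> \<mu> \<phi> \<and> \<phi> 0 = 1)"

definition Omega ::
  "'a::euclidean_space itself \<Rightarrow> nat \<Rightarrow> real \<Rightarrow> real \<Rightarrow> (real \<Rightarrow> complex) set" where
  "Omega T k \<rho> p = (let \<kappa> = - 1 / \<rho>\<^sup>2 in
     {phi T k \<rho> \<mu> | \<mu>. phi T k \<rho> \<mu> 0 = 1 \<and>
        Re \<mu> \<le> - \<kappa> * (p\<^sup>2 + (real k)\<^sup>2 / 4) + (Im \<mu>)\<^sup>2 / (4 * \<kappa> * p\<^sup>2)})"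

end

theory Submission
  imports Defs "HOL-Complex_Analysis.Complex_Analysis"
    "HOL-Computational_Algebra.Fundamental_Theorem_Algebra"
begin

text \<open>
  Put \<open>s\<^sup>2 = \<rho>\<^sup>2 \<mu> - k\<^sup>2/4\<close> and \<open>R = r/\<rho>\<close>. Averaging powers of the Busemann function over a geodesic sphere
  represents \<open>\<phi>\<^sub>\<mu>(r)\<close> as the integral of \<open>cos(s l)\<close> against a positive measure in \<open>l\<close> supported in \<open>[-R, R]\<close>, and
  \<open>\<Omega>(p)\<close> is the set of those \<open>\<phi>\<^sub>\<mu>\<close> with \<open>\<bar>Re s\<bar> \<le> p\<close>. When \<open>p R \<le> \<pi>/2\<close>, the derivative in \<open>s\<close> of this integral has
  negative real part on the convex set \<open>0 < Re s \<le> p\<close>, and on the imaginary axis the integral is a strictly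
  monotone function of \<open>\<bar>Im s\<bar>\<close>; hence the value at \<open>r\<close> determines \<open>s\<^sup>2\<close>. On the other hand the integral is an
  even entire function of \<open>s\<close> of exponential type which is bounded on the real axis and not constant, so it
  takes every value infinitely often, and at most one of the resulting eigenvalues belongs to \<open>\<Omega>(p)\<close>.
\<close>

subsection \<open>Radial functions of class C2\<close>

text \<open>Rank-one operators, bundled as bounded linear maps: gradients and Hessians of radial
  functions are built from them as elements of the operator spaces that
  \<open>twice_cont_diff_on\<close> asks for.\<close>

definition dyad :: "'b::real_normed_vector \<Rightarrow> 'a::euclidean_space \<Rightarrow> 'a \<Rightarrow>\<^sub>L 'b" where
  "dyad c x = blinfun_scaleR_left c o\<^sub>L blinfun_inner_left x"

lemma dyad_apply [simp]: "blinfun_apply (dyad c x) v = (v \<bullet> x) *\<^sub>R c"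
  by (simp add: dyad_def)

lemma bounded_bilinear_dyad: "bounded_bilinear dyad"
  unfolding dyad_def[abs_def]
  by (intro bounded_bilinear.comp[OF bounded_bilinear_blinfun_compose]
      bounded_linear_blinfun_scaleR_left bounded_linear_blinfun_inner_left)

lemmas tendsto_dyad [tendsto_intros] = bounded_bilinear.tendsto[OF bounded_bilinear_dyad]
lemmas has_derivative_dyad = bounded_bilinear.FDERIV[OF bounded_bilinear_dyad]

lemma norm_dyad_le: "norm (dyad c x) \<le> norm c * norm x"
proof (rule norm_blinfun_bound)
  fix v :: 'a
  have "norm c * \<bar>v \<bullet> x\<bar> \<le> norm c * (norm v * norm x)"
    by (intro mult_left_mono Cauchy_Schwarz_ineq2) auto
  then show "norm (dyad c x v) \<le> norm c * norm x * norm v"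
    by (simp add: mult_ac)
qed simp

text \<open>The isotropic part of a radial Hessian: the Euclidean inner product with coefficient
  \<open>c\<close>, expanded over \<open>Basis\<close> so that limits in \<open>c\<close> reduce to
  those of dyads.\<close>

definition scaled_metric :: "'b::real_normed_vector \<Rightarrow> 'a::euclidean_space \<Rightarrow>\<^sub>L 'a \<Rightarrow>\<^sub>L 'b" where
  "scaled_metric c = (\<Sum>i\<in>Basis. dyad (dyad c i) i)"

lemma scaled_metric_apply [simp]: "blinfun_apply (scaled_metric c) v = dyad c v"
  by (rule blinfun_eqI) (simp add: scaled_metric_def blinfun.sum_left blinfun.scaleR_left
      euclidean_inner[of _ v] flip: scaleR_sum_left, simp add: mult.commute)

lemma tendsto_scaled_metric [tendsto_intros]:
  "(f \<longlongrightarrow> c) F \<Longrightarrow> ((\<lambda>x. scaled_metric (f x)) \<longlongrightarrow> scaled_metric c) F"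
  unfolding scaled_metric_def by (intro tendsto_intros)

lemma filterlim_norm_at_0: "filterlim norm (at 0) (at (0::'a::real_normed_vector))"
  unfolding filterlim_at by (auto intro!: tendsto_eq_intros simp: eventually_at_filter)

text \<open>With \<open>q t = E' t / t\<close>, the gradient of \<open>E (norm x)\<close> is
  \<open>q x\<close>, and its Hessian is \<open>q\<close> times the metric plus
  \<open>E'' - q\<close> times the square of the radial direction. Since \<open>E' 0 = 0\<close>,
  the quotient \<open>q\<close> extends continuously to 0 with value \<open>E'' 0\<close>.\<close>

lemma radial_twice_cont_diff_on_ball:
  fixes E E' E'' :: "real \<Rightarrow> 'b::real_normed_vector"
  assumes D1: "\<And>t. \<bar>t\<bar> < \<rho> \<Longrightarrow> (E has_vector_derivative E' t) (at t)"
    and D2: "\<And>t. \<bar>t\<bar> < \<rho> \<Longrightarrow> (E' has_vector_derivative E'' t) (at t)"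
    and cont: "\<And>t. \<bar>t\<bar> < \<rho> \<Longrightarrow> isCont E'' t"
    and E'_0: "E' 0 = 0" and \<rho>: "\<rho> > 0"
  shows "(\<lambda>x::'a::euclidean_space. E (norm x)) twice_cont_diff_on ball 0 \<rho>"
proof -
  define q where "q = (\<lambda>t. if t = 0 then E'' 0 else E' t /\<^sub>R t)"
  define f' where "f' = (\<lambda>x::'a. dyad (q (norm x)) x)"
  define f'' where "f'' = (\<lambda>x::'a. scaled_metric (q (norm x)) +
      dyad (dyad (E'' (norm x) - q (norm x)) (sgn x)) (sgn x))"
  have q0: "(q \<longlongrightarrow> E'' 0) (at 0)"
  proof -
    have "((\<lambda>t. norm (E' t - E' 0 - (t - 0) *\<^sub>R E'' 0) / norm (t - 0)) \<longlongrightarrow> 0) (at 0)"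
      using D2[of 0] \<rho> unfolding has_vector_derivative_def has_derivative_iff_norm by auto
    moreover have "norm (E' t - E' 0 - (t - 0) *\<^sub>R E'' 0) / norm (t - 0) = norm (q t - E'' 0)" if "t \<noteq> 0" for t
    proof -
      have "q t - E'' 0 = (E' t - t *\<^sub>R E'' 0) /\<^sub>R t"
        using that by (simp add: q_def scaleR_diff_right)
      then show ?thesis using E'_0 by (simp add: divide_inverse mult.commute)
    qed
    ultimately have "((\<lambda>t. norm (q t - E'' 0)) \<longlongrightarrow> 0) (at 0)"
      by (auto elim!: Lim_transform_eventually simp: eventually_at_filter)
    then show ?thesis by (metis Lim_null tendsto_norm_zero_iff)
  qed
  then have q0': "((\<lambda>x::'a. q (norm x)) \<longlongrightarrow> E'' 0) (at 0)"
    by (rule filterlim_compose[OF _ filterlim_norm_at_0])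
  have q_deriv: "(q has_vector_derivative ((E'' t - q t) /\<^sub>R t)) (at t)" if "0 < t" "t < \<rho>" for t
  proof -
    have "((\<lambda>t. E' t /\<^sub>R t) has_vector_derivative ((E'' t - q t) /\<^sub>R t)) (at t)"
      using that by (auto intro!: derivative_eq_intros D2 simp: q_def scaleR_diff_right power2_eq_square)
    then show ?thesis
      by (rule has_vector_derivative_transform_within_open[where S = "{0<..}"])
        (use that in \<open>auto simp: q_def\<close>)
  qed
  have 1: "((\<lambda>x. E (norm x)) has_derivative f' x) (at x)" if x: "x \<in> ball 0 \<rho>" for x :: 'a
  proof (cases "x = 0")
    case True
    have "((\<lambda>t. norm (E t - E 0 - (t - 0) *\<^sub>R 0) / norm (t - 0)) \<longlongrightarrow> 0) (at 0)"
      using D1[of 0] \<rho> E'_0 unfolding has_vector_derivative_def has_derivative_iff_norm by auto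
    from filterlim_compose[OF this filterlim_norm_at_0[where 'a='a]] show ?thesis
      unfolding True has_derivative_iff_norm by (simp add: f'_def blinfun.bounded_linear_right)
  next
    case False
    have "((\<lambda>x. E (norm x)) has_derivative (\<lambda>h. (h \<bullet> sgn x) *\<^sub>R E' (norm x))) (at x)"
      using has_derivative_compose[OF has_derivative_norm[OF False] 
          D1[of "norm x", unfolded has_vector_derivative_def]] x
      by (simp add: )
    moreover have "(\<lambda>h. (h \<bullet> sgn x) *\<^sub>R E' (norm x)) = blinfun_apply (f' x)"
      using False by (auto simp: f'_def q_def sgn_div_norm)
    ultimately show ?thesis by simp
  qed
  have 2: "(f' has_derivative f'' x) (at x)" if x: "x \<in> ball 0 \<rho>" for x :: 'a
  proof (cases "x = 0")
    case True
    \<comment> \<open>At the origin only the isotropic part of \<open>f''\<close> survives, so the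
      first-order error of \<open>f'\<close> is the dyad of \<open>q (norm y) - E'' 0\<close> with
      \<open>y\<close>.\<close>
    have le: "norm (f' y - f' 0 - f'' 0 (y - 0)) / norm (y - 0) \<le> norm (q (norm y) - E'' 0)" for y
    proof -
      have "f' y - f' 0 - f'' 0 (y - 0) = dyad (q (norm y) - E'' 0) y"
        by (simp add: f'_def f''_def q_def blinfun.add_left bounded_bilinear.diff_left[OF bounded_bilinear_dyad]
            bounded_bilinear.zero_right[OF bounded_bilinear_dyad])
      then show ?thesis using norm_dyad_le[of "q (norm y) - E'' 0" y]
        by (simp add: divide_le_eq)
    qed
    have lim: "((\<lambda>y::'a. norm (q (norm y) - E'' 0)) \<longlongrightarrow> 0) (at 0)"
      using q0' by (metis Lim_null tendsto_norm_zero_iff)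
    have "((\<lambda>y. norm (f' y - f' 0 - f'' 0 (y - 0)) / norm (y - 0)) \<longlongrightarrow> 0) (at 0)"
      by (rule Lim_null_comparison[OF always_eventually lim]) (use le in simp)
    then show ?thesis unfolding True has_derivative_iff_norm 
      by (simp add: blinfun.bounded_linear_right)
  next
    case False
    define D where "D = (E'' (norm x) - q (norm x)) /\<^sub>R norm x"
    have "((\<lambda>x. q (norm x)) has_derivative (\<lambda>h. (h \<bullet> sgn x) *\<^sub>R D)) (at x)"
      using has_derivative_compose[OF has_derivative_norm[OF False] 
          q_deriv[of "norm x", unfolded has_vector_derivative_def]] x False
      by (simp add: D_def)
    then have "(f' has_derivative (\<lambda>h. dyad (q (norm x)) h + dyad ((h \<bullet> sgn x) *\<^sub>R D) x)) (at x)"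
      unfolding f'_def by (rule has_derivative_dyad) (rule has_derivative_ident)
    moreover have "dyad (q (norm x)) h + dyad ((h \<bullet> sgn x) *\<^sub>R D) x = f'' x h" for h
      by (rule blinfun_eqI)
        (use False in \<open>simp add: f''_def D_def blinfun.add_left blinfun.scaleR_left sgn_div_norm mult_ac\<close>)
    ultimately show ?thesis by simp
  qed
  have 3: "isCont f'' x" if x: "x \<in> ball 0 \<rho>" for x :: 'a
  proof (cases "x = 0")
    case True
    have E'': "((\<lambda>x::'a. E'' (norm x)) \<longlongrightarrow> E'' 0) (at 0)"
      using filterlim_compose[OF cont[of 0, unfolded isCont_def] filterlim_norm_at_0] \<rho> by auto
    \<comment> \<open>The direction \<open>sgn x\<close> has no limit at the origin, but its
      coefficient tends to \<open>E'' 0 - E'' 0 = 0\<close>.\<close>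
    have "((\<lambda>x::'a. dyad (dyad (E'' (norm x) - q (norm x)) (sgn x)) (sgn x)) \<longlongrightarrow> 0) (at 0)"
    proof (rule Lim_null_comparison)
      show "((\<lambda>x::'a. norm (E'' (norm x) - q (norm x))) \<longlongrightarrow> 0) (at 0)"
        using tendsto_diff[OF E'' q0'] by (simp add: tendsto_norm_zero)
      have "norm (dyad (dyad c (sgn x)) (sgn x)) \<le> norm c" for c :: 'b and x :: 'a
      proof (cases "x = 0")
        case False
        then show ?thesis using norm_dyad_le[of "dyad c (sgn x)" "sgn x"] norm_dyad_le[of c "sgn x"]
          by (simp add: norm_sgn)
      qed (simp add: bounded_bilinear.zero_right[OF bounded_bilinear_dyad])
      then show "\<forall>\<^sub>F x::'a in at 0. norm (dyad (dyad (E'' (norm x) - q (norm x)) (sgn x)) (sgn x))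
          \<le> norm (E'' (norm x) - q (norm x))"
        by simp
    qed
    then have "(f'' \<longlongrightarrow> scaled_metric (E'' 0) + 0) (at 0)"
      unfolding f''_def by (intro tendsto_intros q0')
    then show ?thesis unfolding True isCont_def
      by (simp add: f''_def q_def bounded_bilinear.zero_right[OF bounded_bilinear_dyad])
  next
    case False
    have nx: "0 < norm x" "norm x < \<rho>" using False x by auto
    have "isCont q (norm x)" using q_deriv[OF nx] has_vector_derivative_continuous by blast
    then have "((\<lambda>x. q (norm x)) \<longlongrightarrow> q (norm x)) (at x)"
      by (rule isCont_tendsto_compose) (intro tendsto_intros)
    moreover have "((\<lambda>x. E'' (norm x)) \<longlongrightarrow> E'' (norm x)) (at x)"
      by (rule isCont_tendsto_compose[OF cont]) (use nx in \<open>auto intro!: tendsto_intros\<close>)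
    ultimately show ?thesis using False unfolding isCont_def f''_def by (intro tendsto_intros) auto
  qed
  show ?thesis unfolding twice_cont_diff_on_def
    using 1 2 3 by (meson has_derivative_at_withinI continuous_at_imp_continuous_on)
qed

subsection \<open>Uniqueness of radial eigenfunctions\<close>

text \<open>For \<open>t = norm x / \<rho>\<close> the argument of \<open>arcosh\<close> in the
  distance equals \<open>cosh (2 * artanh t)\<close>. The new form is differentiable in
  \<open>t\<close> at 0, whereas \<open>arcosh\<close> is singular at 1.\<close>

lemma hyp_dist_0:
  assumes "norm x < \<rho>"
  shows "hyp_dist \<rho> 0 x = \<rho> * (2 * artanh (norm x / \<rho>))"
proof -
  define t where "t = norm x / \<rho>"
  have \<rho>: "\<rho> > 0" using assms norm_ge_zero[of x] by linarith
  have t: "0 \<le> t" "t < 1" using assms \<rho> by (auto simp: t_def)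
  have nx: "norm x = \<rho> * t" using \<rho> by (simp add: t_def)
  have t2: "1 - t\<^sup>2 > 0" using t by (simp add: power_less_one_iff)
  have "exp (2 * artanh t) = (1 + t) / (1 - t)"
    using t by (simp add: artanh_def)
  then have "cosh (2 * artanh t) = ((1 + t) / (1 - t) + (1 - t) / (1 + t)) / 2"
    by (simp add: cosh_def exp_minus)
  also have "\<dots> = (1 + t\<^sup>2) / (1 - t\<^sup>2)"
  proof -
    have "(1 + t) / (1 - t) + (1 - t) / (1 + t) = 2 * (1 + t\<^sup>2) / ((1 - t) * (1 + t))"
      using t by (simp add: add_frac_eq power2_eq_square algebra_simps)
    also have "(1 - t) * (1 + t) = 1 - t\<^sup>2" by (simp add: power2_eq_square algebra_simps)
    finally have "(1 + t) / (1 - t) + (1 - t) / (1 + t) = 2 * ((1 + t\<^sup>2) / (1 - t\<^sup>2))"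
      by (simp only: times_divide_eq_right)
    then show ?thesis by (metis nonzero_mult_div_cancel_left zero_neq_numeral)
  qed
  also have "\<dots> = 1 + 2 * \<rho>\<^sup>2 * (dist 0 x)\<^sup>2 / ((\<rho>\<^sup>2 - (norm (0::'a))\<^sup>2) * (\<rho>\<^sup>2 - (norm x)\<^sup>2))"
  proof -
    have "\<rho>\<^sup>2 - (norm x)\<^sup>2 = \<rho>\<^sup>2 * (1 - t\<^sup>2)" by (simp add: nx power_mult_distrib algebra_simps)
    then have "2 * \<rho>\<^sup>2 * (dist 0 x)\<^sup>2 / ((\<rho>\<^sup>2 - (norm (0::'a))\<^sup>2) * (\<rho>\<^sup>2 - (norm x)\<^sup>2)) =
        ((\<rho>\<^sup>2 * \<rho>\<^sup>2) * (2 * t\<^sup>2)) / ((\<rho>\<^sup>2 * \<rho>\<^sup>2) * (1 - t\<^sup>2))"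
      by (simp add: nx power_mult_distrib mult_ac)
    also have "\<dots> = 2 * t\<^sup>2 / (1 - t\<^sup>2)"
      by (rule nonzero_mult_divide_mult_cancel_left) (use \<rho> in simp)
    finally have eq: "2 * \<rho>\<^sup>2 * (dist 0 x)\<^sup>2 / ((\<rho>\<^sup>2 - (norm (0::'a))\<^sup>2) * (\<rho>\<^sup>2 - (norm x)\<^sup>2)) =
        2 * t\<^sup>2 / (1 - t\<^sup>2)" .
    show ?thesis unfolding eq using t2 by (simp add: divide_simps)
  qed
  finally have "hyp_dist \<rho> 0 x = \<rho> * arcosh (cosh (2 * artanh t))"
    by (simp add: hyp_dist_def)
  moreover have "0 \<le> artanh t" using t by (simp add: artanh_def)
  ultimately show ?thesis by (simp add: arcosh_cosh_real t_def)
qed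

lemma hyp_dist_minus: "hyp_dist \<rho> 0 (- x) = hyp_dist \<rho> 0 x"
  by (simp add: hyp_dist_def)

text \<open>The \<open>C\<^sup>1\<close> condition at the origin makes the gradient vanish there, because the function is even.\<close>

lemma radial_eigenfunction_boundary:
  assumes eig: "radial_eigenfunction TYPE('a::euclidean_space) k \<rho> \<mu> \<phi>" and \<rho>: "\<rho> > 0"
    and der: "\<And>r. r > 0 \<Longrightarrow> (\<phi> has_vector_derivative \<phi>' r) (at r)"
  shows "(\<phi> \<longlongrightarrow> \<phi> 0) (at_right 0)" and "(\<phi>' \<longlongrightarrow> 0) (at_right 0)"
proof -
  define F where "F = (\<lambda>x::'a. \<phi> (hyp_dist \<rho> 0 x))"
  obtain F' F'' where F': "\<And>x. x \<in> ball 0 \<rho> \<Longrightarrow> (F has_derivative blinfun_apply (F' x)) (at x)"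
    and F'': "\<And>x. x \<in> ball 0 \<rho> \<Longrightarrow> (F' has_derivative blinfun_apply (F'' x)) (at x)"
    using eig unfolding radial_eigenfunction_def twice_cont_diff_on_def F_def
    by (metis at_within_open open_ball)
  have ball0: "(0::'a) \<in> ball 0 \<rho>" using \<rho> by simp
  have "((\<lambda>x. F (- x)) has_derivative (\<lambda>v. F' 0 (- v))) (at 0)"
    by (rule has_derivative_compose[of uminus uminus 0 UNIV F "F' 0"])
      (auto intro!: derivative_eq_intros simp: F'[OF ball0])
  moreover have "(\<lambda>x. F (- x)) = F" by (simp add: F_def hyp_dist_minus)
  ultimately have "(\<lambda>v. F' 0 (- v)) = F' 0"
    using has_derivative_unique F'[OF ball0] by metis
  then have "- F' 0 v = F' 0 v" for v by (metis blinfun.minus_right)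
  then have F'0: "F' 0 = 0" by (intro blinfun_eqI) (simp add: eq_neg_iff_add_eq_0 flip: scaleR_2)
  have F'_lim: "(F' \<longlongrightarrow> 0) (at 0)"
    using has_derivative_continuous[OF F''[OF ball0]] by (simp add: isCont_def F'0)
  have F_lim: "isCont F 0"
    using has_derivative_continuous[OF F'[OF ball0]] .
  obtain e :: 'a where e: "norm e = 1" using norm_Basis nonempty_Basis by blast
  \<comment> \<open>The unit-speed geodesic ray from the origin in direction \<open>e\<close>:
    \<open>\<gamma> r\<close> has hyperbolic distance \<open>r\<close> to the origin, so
    \<open>F\<close> along it is the profile \<open>\<phi>\<close>.\<close>
  define \<gamma> where "\<gamma> = (\<lambda>r. (\<rho> * tanh (r / (2 * \<rho>))) *\<^sub>R e)"
  define \<gamma>' where "\<gamma>' = (\<lambda>r. ((1 - (tanh (r / (2 * \<rho>)))\<^sup>2) / 2) *\<^sub>R e)"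
  have \<gamma>_der: "(\<gamma> has_vector_derivative \<gamma>' r) (at r)" for r
  proof -
    have "((\<lambda>r. \<rho> * tanh (r / (2 * \<rho>))) has_real_derivative (1 - (tanh (r / (2 * \<rho>)))\<^sup>2) / 2) (at r)"
      using \<rho> by (auto intro!: derivative_eq_intros)
    then show ?thesis
      unfolding \<gamma>_def \<gamma>'_def has_real_derivative_iff_has_vector_derivative
      by (rule bounded_linear.has_vector_derivative[OF bounded_linear_scaleR_left])
  qed
  have norm_\<gamma>: "norm (\<gamma> r) = \<rho> * tanh (r / (2 * \<rho>))" if "r \<ge> 0" for r
    using that \<rho> by (simp add: \<gamma>_def e abs_mult)
  have \<gamma>_ball: "\<gamma> r \<in> ball 0 \<rho>" if "r \<ge> 0" for r
    using norm_\<gamma>[OF that] \<rho> tanh_real_lt_1[of "r / (2 * \<rho>)"] by simp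
  have F\<gamma>: "F (\<gamma> r) = \<phi> r" if "r \<ge> 0" for r
    using \<gamma>_ball[OF that] \<rho> that by (simp add: F_def hyp_dist_0 norm_\<gamma> artanh_tanh_real)
  have \<phi>'_eq: "\<phi>' r = F' (\<gamma> r) (\<gamma>' r)" if "r > 0" for r
  proof -
    have "((\<lambda>r. F (\<gamma> r)) has_vector_derivative F' (\<gamma> r) (\<gamma>' r)) (at r)"
      using vector_derivative_diff_chain_within[OF \<gamma>_der, OF has_derivative_at_withinI[OF F'], of r]
        \<gamma>_ball[of r] that by (simp add: o_def)
    then have "(\<phi> has_vector_derivative F' (\<gamma> r) (\<gamma>' r)) (at r)"
      by (rule has_vector_derivative_transform_within_open[where S = "{0<..}"]) (use that F\<gamma> in auto)
    then show ?thesis using der[OF that] vector_derivative_unique_at by blast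
  qed
  have \<gamma>_lim: "(\<gamma> \<longlongrightarrow> 0) (at_right 0)"
    unfolding \<gamma>_def using \<rho> by (auto intro!: tendsto_eq_intros)
  have "((\<lambda>r. F (\<gamma> r)) \<longlongrightarrow> F 0) (at_right 0)"
    by (rule isCont_tendsto_compose[OF F_lim \<gamma>_lim])
  moreover have "F 0 = \<phi> 0" using F\<gamma>[of 0] by (simp add: \<gamma>_def)
  ultimately show "(\<phi> \<longlongrightarrow> \<phi> 0) (at_right 0)"
    using F\<gamma> by (auto elim!: Lim_transform_eventually simp: eventually_at_filter)
  have "isCont F' 0" using F'_lim F'0 by (simp add: isCont_def)
  then have "((\<lambda>r. F' (\<gamma> r)) \<longlongrightarrow> 0) (at_right 0)"
    using isCont_tendsto_compose[OF _ \<gamma>_lim] F'0 by fastforce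
  moreover have "(\<gamma>' \<longlongrightarrow> (1 / 2) *\<^sub>R e) (at_right 0)"
    unfolding \<gamma>'_def using \<rho> by (auto intro!: tendsto_eq_intros)
  ultimately have "((\<lambda>r. F' (\<gamma> r) (\<gamma>' r)) \<longlongrightarrow> blinfun_apply 0 ((1 / 2) *\<^sub>R e)) (at_right 0)"
    by (intro tendsto_intros)
  then have "((\<lambda>r. F' (\<gamma> r) (\<gamma>' r)) \<longlongrightarrow> 0) (at_right 0)" by simp
  then show "(\<phi>' \<longlongrightarrow> 0) (at_right 0)"
    by (rule Lim_transform_eventually) (use \<phi>'_eq in \<open>auto simp: eventually_at_filter\<close>)
qed

text \<open>The energy \<open>|d|\<^sup>2 + |d'|\<^sup>2\<close> grows at most exponentially, since the singular damping term has a favourable sign.\<close>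

lemma damped_ode_zero:
  fixes d d' d'' :: "real \<Rightarrow> complex" and c :: "real \<Rightarrow> real"
  assumes d: "\<And>r. r > 0 \<Longrightarrow> (d has_vector_derivative d' r) (at r)"
    and d': "\<And>r. r > 0 \<Longrightarrow> (d' has_vector_derivative d'' r) (at r)"
    and ode: "\<And>r. r > 0 \<Longrightarrow> d'' r + of_real (c r) * d' r + \<mu> * d r = 0"
    and c: "\<And>r. r > 0 \<Longrightarrow> c r \<ge> 0"
    and lim: "(d \<longlongrightarrow> 0) (at_right 0)" "(d' \<longlongrightarrow> 0) (at_right 0)" and r: "r > 0"
  shows "d r = 0"
proof -
  \<comment> \<open>Cauchy-Schwarz bounds the derivative of \<open>e\<close> by
    \<open>2 * (1 + norm \<mu>) * norm (d s) * norm (d' s)\<close>, hence by \<open>C * e s\<close>;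
    the factor \<open>exp (- C * r)\<close> therefore makes \<open>h\<close> nonincreasing.\<close>
  define C where "C = 1 + norm \<mu>"
  define e where "e = (\<lambda>r. d r \<bullet> d r + d' r \<bullet> d' r)"
  define h where "h = (\<lambda>r. exp (- C * r) * e r)"
  have h_der: "\<exists>y. (h has_real_derivative y) (at s) \<and> y \<le> 0" if s: "s > 0" for s
  proof -
    let ?e' = "2 * (d s \<bullet> d' s) + 2 * (d' s \<bullet> d'' s)"
    have "(e has_real_derivative ?e') (at s)"
      unfolding e_def has_field_derivative_def
      using d[OF s] d'[OF s] unfolding has_vector_derivative_def
      by (auto intro!: derivative_eq_intros simp: inner_commute algebra_simps)
    then have "(h has_real_derivative (exp (- C * s) * (?e' - C * e s))) (at s)"
      unfolding h_def by (auto intro!: derivative_eq_intros simp: algebra_simps)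
    moreover have "?e' \<le> C * e s"
    proof -
      have "d'' s = - (c s *\<^sub>R d' s) - \<mu> * d s"
        using ode[OF s] by (simp add: scaleR_conv_of_real algebra_simps eq_neg_iff_add_eq_0)
      then have "d' s \<bullet> d'' s = - c s * (d' s \<bullet> d' s) - d' s \<bullet> (\<mu> * d s)"
        by (simp add: inner_diff_right)
      also have "\<dots> \<le> norm (d' s) * norm (\<mu> * d s)"
        using c[OF s] Cauchy_Schwarz_ineq2[of "d' s" "\<mu> * d s"]
          mult_nonneg_nonneg[OF c[OF s] inner_ge_zero[of "d' s"]] by linarith
      finally have 1: "d' s \<bullet> d'' s \<le> norm \<mu> * (norm (d s) * norm (d' s))"
        by (simp add: norm_mult mult_ac)
      have 2: "d s \<bullet> d' s \<le> norm (d s) * norm (d' s)" by (rule norm_cauchy_schwarz)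
      have "2 * (norm (d s) * norm (d' s)) \<le> e s"
        using sum_squares_bound[of "norm (d s)" "norm (d' s)"]
        by (simp add: e_def power2_norm_eq_inner algebra_simps)
      then have "C * (2 * (norm (d s) * norm (d' s))) \<le> C * e s"
        by (intro mult_left_mono) (auto simp: C_def)
      then show ?thesis using 1 2 by (simp add: C_def algebra_simps)
    qed
    ultimately show ?thesis by (intro exI conjI) (auto intro!: mult_nonneg_nonpos)
  qed
  have "h r \<le> h s" if "0 < s" "s < r" for s
    by (rule DERIV_nonpos_imp_nonincreasing[of s r h]) (use that h_der in \<open>auto intro: less_imp_le\<close>)
  then have "\<forall>\<^sub>F s in at_right 0. h r \<le> h s"
    using r by (auto simp: eventually_at_right_field)
  moreover have "(h \<longlongrightarrow> exp (- C * 0) * (0 \<bullet> (0::complex) + 0 \<bullet> (0::complex))) (at_right 0)"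
    unfolding h_def e_def by (intro tendsto_intros lim)
  ultimately have "h r \<le> 0"
    by (intro tendsto_lowerbound[of h 0 "at_right 0"]) auto
  then have "e r \<le> 0" by (simp add: h_def mult_le_0_iff)
  then show ?thesis unfolding e_def
    by (metis add_nonneg_eq_0_iff antisym inner_eq_zero_iff inner_ge_zero add_nonneg_nonneg)
qed

text \<open>The difference of two solutions satisfies the same linear equation, and both it and its
  derivative tend to 0 at the origin, so the energy estimate forces it to vanish.\<close>

lemma radial_eigenfunction_unique:
  assumes f: "radial_eigenfunction TYPE('a::euclidean_space) k \<rho> \<mu> f"
    and g: "radial_eigenfunction TYPE('a) k \<rho> \<mu> g"
    and eq0: "f 0 = g 0" and \<rho>: "\<rho> > 0"
  shows "f = g"
proof (rule extensionalityI)
  show "f \<in> extensional {0..}" "g \<in> extensional {0..}"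
    using f g by (auto simp: radial_eigenfunction_def)
  define c where "c = (\<lambda>r. real k / \<rho> * (cosh (r / \<rho>) / sinh (r / \<rho>)))"
  obtain f' f'' where f': "\<And>r. r > 0 \<Longrightarrow> (f has_vector_derivative f' r) (at r)"
      "\<And>r. r > 0 \<Longrightarrow> (f' has_vector_derivative f'' r) (at r)"
      "\<And>r. r > 0 \<Longrightarrow> f'' r + of_real (c r) * f' r + \<mu> * f r = 0"
    using f unfolding radial_eigenfunction_def c_def by blast
  obtain g' g'' where g': "\<And>r. r > 0 \<Longrightarrow> (g has_vector_derivative g' r) (at r)"
      "\<And>r. r > 0 \<Longrightarrow> (g' has_vector_derivative g'' r) (at r)"
      "\<And>r. r > 0 \<Longrightarrow> g'' r + of_real (c r) * g' r + \<mu> * g r = 0"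
    using g unfolding radial_eigenfunction_def c_def by blast
  fix r :: real assume "r \<in> {0..}"
  show "f r = g r"
  proof (cases "r = 0")
    case False
    with \<open>r \<in> {0..}\<close> have r: "r > 0" by simp
    have "f r - g r = 0"
    proof (rule damped_ode_zero[where d' = "\<lambda>r. f' r - g' r" and d'' = "\<lambda>r. f'' r - g'' r" and c = c and \<mu> = \<mu>])
      fix s :: real assume s: "s > 0"
      show "((\<lambda>r. f r - g r) has_vector_derivative f' s - g' s) (at s)"
        "((\<lambda>r. f' r - g' r) has_vector_derivative f'' s - g'' s) (at s)"
        using f'(1,2)[OF s] g'(1,2)[OF s] by (auto intro!: derivative_intros)
      show "f'' s - g'' s + of_real (c s) * (f' s - g' s) + \<mu> * (f s - g s) = 0"
      proof -
        have "f'' s - g'' s + of_real (c s) * (f' s - g' s) + \<mu> * (f s - g s) =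
          (f'' s + of_real (c s) * f' s + \<mu> * f s) - (g'' s + of_real (c s) * g' s + \<mu> * g s)"
          by (simp add: algebra_simps)
        then show ?thesis by (simp only: f'(3)[OF s] g'(3)[OF s] diff_self)
      qed
      show "0 \<le> c s" using s \<rho> by (simp add: c_def)
    next
      show "((\<lambda>r. f r - g r) \<longlongrightarrow> 0) (at_right 0)"
        using tendsto_diff[OF radial_eigenfunction_boundary(1)[OF f \<rho> f'(1)]
            radial_eigenfunction_boundary(1)[OF g \<rho> g'(1)]] eq0 by simp
      show "((\<lambda>r. f' r - g' r) \<longlongrightarrow> 0) (at_right 0)"
        using tendsto_diff[OF radial_eigenfunction_boundary(2)[OF f \<rho> f'(1)]
            radial_eigenfunction_boundary(2)[OF g \<rho> g'(1)]] by simp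
    qed (use r in auto)
    then show ?thesis by simp
  qed (use eq0 in simp)
qed

subsection \<open>The integral representation\<close>

text \<open>In curvature -1, the exponential of the Busemann function at the point with polar
  coordinates \<open>r\<close>, \<open>\<theta>\<close>, the angle being measured from the direction
  opposite to the boundary point.\<close>

definition horo :: "real \<Rightarrow> real \<Rightarrow> real" where
  "horo r \<theta> = cosh r + sinh r * cos \<theta>"

lemma horo_bounds:
  shows horo_ge: "exp (- \<bar>r\<bar>) \<le> horo r \<theta>" and horo_le: "horo r \<theta> \<le> exp \<bar>r\<bar>"
proof -
  have "\<bar>sinh r * cos \<theta>\<bar> \<le> \<bar>sinh r\<bar> * 1"
    unfolding abs_mult by (intro mult_left_mono) auto
  moreover have "\<bar>sinh r\<bar> = sinh \<bar>r\<bar>" by (simp add: abs_if)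
  moreover have "cosh r = cosh \<bar>r\<bar>" by simp
  ultimately have "cosh \<bar>r\<bar> - sinh \<bar>r\<bar> \<le> horo r \<theta>" "horo r \<theta> \<le> cosh \<bar>r\<bar> + sinh \<bar>r\<bar>"
    unfolding horo_def by linarith+
  then show "exp (- \<bar>r\<bar>) \<le> horo r \<theta>" "horo r \<theta> \<le> exp \<bar>r\<bar>"
    by (simp_all only: cosh_minus_sinh cosh_plus_sinh)
qed

lemma horo_pos: "horo r \<theta> > 0"
  using horo_ge[of r \<theta>] exp_gt_zero by (rule less_le_trans[rotated])

lemma continuous_on_horo [continuous_intros]:
  fixes A :: "'a::t2_space set"
  shows "continuous_on A f \<Longrightarrow> continuous_on A g \<Longrightarrow> continuous_on A (\<lambda>x. horo (f x) (g x))"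
  unfolding horo_def by (intro continuous_intros)

text \<open>The complex power of \<open>horo\<close>, taken through the real logarithm: no branch
  has to be chosen and the dependence on \<open>a\<close> is entire.\<close>

definition pw :: "complex \<Rightarrow> real \<Rightarrow> real \<Rightarrow> complex" where
  "pw a r \<theta> = exp (a * of_real (ln (horo r \<theta>)))"

lemma continuous_on_pw [continuous_intros]:
  fixes A :: "'a::t2_space set"
  shows "continuous_on A f \<Longrightarrow> continuous_on A g \<Longrightarrow> continuous_on A (\<lambda>x. pw a (f x) (g x))"
  unfolding pw_def using horo_pos by (intro continuous_intros) (auto simp: less_imp_neq[symmetric])

lemma pw_diff_1: "pw (a - 1) r \<theta> * of_real (horo r \<theta>) = pw a r \<theta>"
proof -
  have "of_real (horo r \<theta>) = exp (complex_of_real (ln (horo r \<theta>)))"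
    by (simp add: horo_pos exp_of_real)
  then show ?thesis by (simp add: pw_def algebra_simps flip: exp_add)
qed

lemma has_vector_derivative_pw:
  assumes "((\<lambda>x. horo (f x) (g x)) has_real_derivative D) (at x within A)"
  shows "((\<lambda>x. pw a (f x) (g x)) has_vector_derivative a * pw (a - 1) (f x) (g x) * of_real D) (at x within A)"
proof -
  let ?h = "horo (f x) (g x)"
  have "((\<lambda>x. ln (horo (f x) (g x))) has_real_derivative D / ?h) (at x within A)"
    using assms horo_pos[of "f x" "g x"]
    by (auto intro!: derivative_eq_intros)
  then have "((\<lambda>x. a * of_real (ln (horo (f x) (g x)))) has_vector_derivative a * of_real (D / ?h)) (at x within A)"
    by (intro has_vector_derivative_mult_right has_vector_derivative_of_real)
  then have "(exp \<circ> (\<lambda>x. a * of_real (ln (horo (f x) (g x)))) has_vector_derivative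
      (a * of_real (D / ?h)) * pw a (f x) (g x)) (at x within A)"
    unfolding pw_def by (intro field_vector_diff_chain_within DERIV_exp has_field_derivative_at_within)
  moreover have "(a * of_real (D / ?h)) * pw a (f x) (g x) = a * pw (a - 1) (f x) (g x) * of_real D"
    using horo_pos[of "f x" "g x"] by (simp flip: pw_diff_1[of a])
  ultimately show ?thesis by (simp only: o_def pw_def[of a "f _"])
qed

text \<open>An unnormalised spherical function: the mean of a power of the Busemann function over a
  geodesic sphere, written as an integral over the polar angle.\<close>

definition psi :: "nat \<Rightarrow> complex \<Rightarrow> real \<Rightarrow> complex" where
  "psi k a r = integral {0..pi} (\<lambda>\<theta>. pw a r \<theta> * of_real (sin \<theta> ^ (k - 1)))"

definition psi1 :: "nat \<Rightarrow> complex \<Rightarrow> real \<Rightarrow> complex" where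
  "psi1 k a r = integral {0..pi} (\<lambda>\<theta>. a * pw (a - 1) r \<theta> * of_real (sinh r + cosh r * cos \<theta>)
     * of_real (sin \<theta> ^ (k - 1)))"

definition psi2 :: "nat \<Rightarrow> complex \<Rightarrow> real \<Rightarrow> complex" where
  "psi2 k a r = integral {0..pi} (\<lambda>\<theta>. a * (pw a r \<theta> +
     (a - 1) * pw (a - 2) r \<theta> * of_real ((sinh r + cosh r * cos \<theta>)\<^sup>2)) * of_real (sin \<theta> ^ (k - 1)))"

section \<open>Differentiation under the integral and the radial equation\<close>

lemma horo_has_derivative_r:
  "((\<lambda>r. horo r \<theta>) has_real_derivative sinh r + cosh r * cos \<theta>) (at r within A)"
  unfolding horo_def by (auto intro!: derivative_eq_intros)

lemma horo_has_derivative_theta: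
  "((\<lambda>\<theta>. horo r \<theta>) has_real_derivative - (sinh r * sin \<theta>)) (at \<theta> within A)"
  unfolding horo_def by (auto intro!: derivative_eq_intros)

lemma has_vector_derivative_psi: "(psi k a has_vector_derivative psi1 k a r) (at r)"
proof -
  have "((\<lambda>r. integral (cbox 0 pi) (\<lambda>\<theta>. pw a r \<theta> * of_real (sin \<theta> ^ (k - 1)))) has_vector_derivative
     integral (cbox 0 pi) (\<lambda>\<theta>. a * pw (a - 1) r \<theta> * of_real (sinh r + cosh r * cos \<theta>) * of_real (sin \<theta> ^ (k - 1))))
     (at r within UNIV)"
  proof (rule leibniz_rule_vector_derivative)
    show "((\<lambda>r. pw a r \<theta> * of_real (sin \<theta> ^ (k - 1))) has_vector_derivative
      a * pw (a - 1) r \<theta> * of_real (sinh r + cosh r * cos \<theta>) * of_real (sin \<theta> ^ (k - 1))) (at r within UNIV)"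
      for r \<theta>
      by (intro has_vector_derivative_mult_left has_vector_derivative_pw horo_has_derivative_r)
  qed (auto intro!: integrable_continuous_interval continuous_intros simp: case_prod_unfold)
  then show ?thesis by (simp add: psi_def[abs_def] psi1_def)
qed

lemma has_vector_derivative_psi1: "(psi1 k a has_vector_derivative psi2 k a r) (at r)"
proof -
  let ?V = "\<lambda>r \<theta>. sinh r + cosh r * cos \<theta>"
  have "((\<lambda>r. integral (cbox 0 pi) (\<lambda>\<theta>. a * pw (a - 1) r \<theta> * of_real (?V r \<theta>) * of_real (sin \<theta> ^ (k - 1))))
    has_vector_derivative integral (cbox 0 pi) (\<lambda>\<theta>. a * (pw a r \<theta> +
     (a - 1) * pw (a - 2) r \<theta> * of_real ((?V r \<theta>)\<^sup>2)) * of_real (sin \<theta> ^ (k - 1))))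
     (at r within UNIV)"
  proof (rule leibniz_rule_vector_derivative)
    fix r \<theta> :: real
    \<comment> \<open>The derivative of \<open>?V\<close> in \<open>r\<close> is \<open>horo\<close>
      again, which lifts the exponent \<open>a - 1\<close> back to \<open>a\<close> in the product
      rule.\<close>
    have "((\<lambda>r. complex_of_real (?V r \<theta>)) has_vector_derivative of_real (horo r \<theta>)) (at r)"
      by (intro has_vector_derivative_of_real)
        (auto intro!: derivative_eq_intros simp: horo_def)
    from has_vector_derivative_mult[OF has_vector_derivative_mult_right[OF has_vector_derivative_pw[OF horo_has_derivative_r]] this, of a "a - 1"]
    have "((\<lambda>r. a * pw (a - 1) r \<theta> * of_real (?V r \<theta>)) has_vector_derivative
        (a * pw (a - 1) r \<theta> * of_real (horo r \<theta>) + 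
         a * ((a - 1) * pw (a - 1 - 1) r \<theta> * of_real (?V r \<theta>)) * of_real (?V r \<theta>))) (at r)" .
    moreover have "(a * pw (a - 1) r \<theta> * of_real (horo r \<theta>) + 
         a * ((a - 1) * pw (a - 1 - 1) r \<theta> * of_real (?V r \<theta>)) * of_real (?V r \<theta>)) =
       a * (pw a r \<theta> + (a - 1) * pw (a - 2) r \<theta> * of_real ((?V r \<theta>)\<^sup>2))"
      unfolding pw_diff_1[of a, symmetric] of_real_power power2_eq_square by (simp add: ring_distribs mult.assoc)
    ultimately show "((\<lambda>r. a * pw (a - 1) r \<theta> * of_real (?V r \<theta>) * of_real (sin \<theta> ^ (k - 1))) has_vector_derivative
       a * (pw a r \<theta> + (a - 1) * pw (a - 2) r \<theta> * of_real ((?V r \<theta>)\<^sup>2)) * of_real (sin \<theta> ^ (k - 1))) (at r within UNIV)"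
      by (intro has_vector_derivative_mult_left) simp
  qed (auto intro!: integrable_continuous_interval continuous_intros simp: case_prod_unfold)
  then show ?thesis by (simp add: psi1_def[abs_def] psi2_def)
qed

lemma continuous_on_psi2: "continuous_on UNIV (psi2 k a)"
proof -
  have "continuous_on UNIV (\<lambda>r. integral (cbox 0 pi) (\<lambda>\<theta>. a * (pw a r \<theta> +
     (a - 1) * pw (a - 2) r \<theta> * of_real ((sinh r + cosh r * cos \<theta>)\<^sup>2)) * of_real (sin \<theta> ^ (k - 1))))"
    by (intro integral_continuous_on_param) (auto intro!: continuous_intros simp: case_prod_unfold)
  then show ?thesis by (simp add: psi2_def[abs_def])
qed

text \<open>The integrand is the derivative in the angle of
  \<open>pw a r \<theta> * sin \<theta> ^ k\<close>, which vanishes at 0 and at \<open>pi\<close>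
  because \<open>k\<close> is positive.\<close>

lemma integral_pw_by_parts:
  assumes k: "k \<ge> 1"
  shows "integral {0..pi} (\<lambda>\<theta>. (of_nat k * of_real (cos \<theta>) * pw a r \<theta>
     - a * of_real (sinh r * (sin \<theta>)\<^sup>2) * pw (a - 1) r \<theta>) * of_real (sin \<theta> ^ (k - 1))) = 0"
proof -
  have "((\<lambda>\<theta>. (of_nat k * of_real (cos \<theta>) * pw a r \<theta>
     - a * of_real (sinh r * (sin \<theta>)\<^sup>2) * pw (a - 1) r \<theta>) * of_real (sin \<theta> ^ (k - 1))) has_integral
     (pw a r pi * of_real (sin pi ^ k) - pw a r 0 * of_real (sin 0 ^ k))) {0..pi}"
  proof (rule fundamental_theorem_of_calculus)
    fix \<theta> :: real
    have "((\<lambda>\<theta>. complex_of_real (sin \<theta> ^ k)) has_vector_derivative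
        of_real (real k * sin \<theta> ^ (k - 1) * cos \<theta>)) (at \<theta> within {0..pi})"
      by (intro has_vector_derivative_of_real)
        (auto intro!: derivative_eq_intros)
    from has_vector_derivative_mult[OF has_vector_derivative_pw[OF horo_has_derivative_theta] this]
    have "((\<lambda>\<theta>. pw a r \<theta> * of_real (sin \<theta> ^ k)) has_vector_derivative
      (pw a r \<theta> * of_real (real k * sin \<theta> ^ (k - 1) * cos \<theta>) +
       a * pw (a - 1) r \<theta> * of_real (- (sinh r * sin \<theta>)) * of_real (sin \<theta> ^ k))) (at \<theta> within {0..pi})" .
    moreover have "sin \<theta> ^ k = sin \<theta> * sin \<theta> ^ (k - 1)" using k by (cases k) auto
    ultimately show "((\<lambda>\<theta>. pw a r \<theta> * of_real (sin \<theta> ^ k)) has_vector_derivative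
      (of_nat k * of_real (cos \<theta>) * pw a r \<theta> - a * of_real (sinh r * (sin \<theta>)\<^sup>2) * pw (a - 1) r \<theta>)
      * of_real (sin \<theta> ^ (k - 1))) (at \<theta> within {0..pi})"
      by (simp add: power2_eq_square algebra_simps)
  qed auto
  then show ?thesis using k by (simp add: integral_unique)
qed

text \<open>The three integrands combine pointwise to \<open>a / sinh r\<close> times the integrand
  of the integration by parts with exponent \<open>a - 1\<close>, so their integral is 0.\<close>

lemma psi_ode:
  assumes k: "k \<ge> 1" and r: "r \<noteq> 0"
  shows "psi2 k a r + of_real (real k * (cosh r / sinh r)) * psi1 k a r - a * (of_nat k + a) * psi k a r = 0"
proof -
  define S where "S = (\<lambda>\<theta>. complex_of_real (sin \<theta> ^ (k - 1)))"
  define V where "V = (\<lambda>\<theta>. sinh r + cosh r * cos \<theta>)"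
  have sinh: "sinh r \<noteq> 0" using r by simp
  let ?f = "\<lambda>\<theta>. a * (pw a r \<theta> + (a - 1) * pw (a - 2) r \<theta> * of_real ((V \<theta>)\<^sup>2)) * S \<theta>"
  let ?g = "\<lambda>\<theta>. a * pw (a - 1) r \<theta> * of_real (V \<theta>) * S \<theta>"
  let ?h = "\<lambda>\<theta>. pw a r \<theta> * S \<theta>"
  let ?C = "complex_of_real (real k * (cosh r / sinh r))"
  let ?i = "\<lambda>\<theta>. (of_nat k * of_real (cos \<theta>) * pw (a - 1) r \<theta>
     - (a - 1) * of_real (sinh r * (sin \<theta>)\<^sup>2) * pw (a - 1 - 1) r \<theta>) * S \<theta>"
  have int: "?f integrable_on {0..pi}" "?g integrable_on {0..pi}" "?h integrable_on {0..pi}"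
    unfolding S_def V_def by (intro integrable_continuous_interval continuous_intros)+
  have "psi2 k a r + ?C * psi1 k a r - a * (of_nat k + a) * psi k a r =
    integral {0..pi} ?f + integral {0..pi} (\<lambda>\<theta>. ?C * ?g \<theta>) - integral {0..pi} (\<lambda>\<theta>. a * (of_nat k + a) * ?h \<theta>)"
    by (simp add: psi_def psi1_def psi2_def V_def S_def)
  also have "\<dots> = integral {0..pi} (\<lambda>\<theta>. ?f \<theta> + ?C * ?g \<theta> - a * (of_nat k + a) * ?h \<theta>)"
    using has_integral_diff[OF has_integral_add[OF int(1)[THEN integrable_integral]
        has_integral_mult_right[OF int(2)[THEN integrable_integral], of ?C]]
        has_integral_mult_right[OF int(3)[THEN integrable_integral], of "a * (of_nat k + a)"]]
    by (simp only: integral_unique integral_mult_right)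
  also have "\<dots> = integral {0..pi} (\<lambda>\<theta>. a / of_real (sinh r) * ?i \<theta>)"
  proof (rule integral_cong)
    fix \<theta>
    define q w v s c sh ch where "q = pw (a - 2) r \<theta>" and "w = complex_of_real (horo r \<theta>)"
      and "v = complex_of_real (V \<theta>)" and "s = complex_of_real (sin \<theta>)" and "c = complex_of_real (cos \<theta>)"
      and "sh = complex_of_real (sinh r)" and "ch = complex_of_real (cosh r)"
    have 1: "pw (a - 1) r \<theta> = q * w" using pw_diff_1[of "a - 1" r \<theta>] by (simp add: q_def w_def)
    have 2: "pw a r \<theta> = q * w * w" using pw_diff_1[of a r \<theta>] 1 by (simp add: w_def)
    have 3: "pw (a - 1 - 1) r \<theta> = q" by (simp add: q_def)
    have w: "w = ch + sh * c" and v: "v = sh + ch * c"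
      by (simp_all add: w_def v_def V_def horo_def ch_def sh_def c_def)
    have sc: "s * s = 1 - c * c"
      using sin_squared_eq[of \<theta>] by (simp add: s_def c_def power2_eq_square flip: of_real_mult)
    have chsh: "ch * ch = 1 + sh * sh"
      using cosh_square_eq[of r] by (simp add: ch_def sh_def power2_eq_square flip: of_real_mult)
    have sh0: "sh \<noteq> 0" using sinh by (simp add: sh_def)
    have k': "complex_of_real (real k * (cosh r / sinh r)) = of_nat k * ch / sh" by (simp add: ch_def sh_def)
    \<comment> \<open>This identity expresses that the gradient of the Busemann function has length
      1.\<close>
    have vv: "v * v = w * w - s * s"
      unfolding w v sc using chsh by algebra
    have cv: "ch * v - sh * w = c" unfolding w v using chsh by algebra
    have "sh * (a * (q * w * w + (a - 1) * q * (v * v)) + of_nat k * ch / sh * (a * (q * w) * v)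
        - a * (of_nat k + a) * (q * w * w)) = a * (of_nat k * c * (q * w) - (a - 1) * (sh * (s * s)) * q)"
      (is "?L = ?R")
    proof -
      have "?L = sh * (a * (q * w * w + (a - 1) * q * (w * w - s * s))
        - a * (of_nat k + a) * (q * w * w)) + of_nat k * (ch * v) * (a * (q * w))"
        using sh0 unfolding vv by (simp add: algebra_simps)
      also have "ch * v = c + sh * w" using cv by (simp add: algebra_simps)
      finally show ?thesis by (simp add: algebra_simps)
    qed
    then have "a * (q * w * w + (a - 1) * q * (v * v)) + of_nat k * ch / sh * (a * (q * w) * v)
        - a * (of_nat k + a) * (q * w * w) = a / sh * (of_nat k * c * (q * w) - (a - 1) * (sh * (s * s)) * q)"
      using sh0 by (simp add: eq_divide_eq mult.commute)
    then have "(a * (q * w * w + (a - 1) * q * (v * v)) + of_nat k * ch / sh * (a * (q * w) * v)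
        - a * (of_nat k + a) * (q * w * w)) * S \<theta> = a / sh * (of_nat k * c * (q * w) - (a - 1) * (sh * (s * s)) * q) * S \<theta>"
      by simp
    then show "?f \<theta> + ?C * ?g \<theta> - a * (of_nat k + a) * ?h \<theta> = a / of_real (sinh r) * ?i \<theta>"
      unfolding 1 2 3 k' unfolding of_real_mult of_real_power power2_eq_square q_def[symmetric] w_def[symmetric]
        v_def[symmetric] s_def[symmetric] c_def[symmetric] sh_def[symmetric]
      by (simp only: mult.assoc left_diff_distrib distrib_right)
  qed
  also have "\<dots> = 0"
    using integral_pw_by_parts[OF k, of "a - 1" r] by (simp add: S_def)
  finally show ?thesis .
qed

section \<open>Normalisation at the origin\<close>

text \<open>Strictness is tested at \<open>pi / 2\<close> because the weights
  \<open>sin \<theta> ^ (k - 1)\<close> are positive there for every \<open>k\<close>, while they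
  may vanish at the endpoints.\<close>

lemma integral_0_pi_pos:
  fixes f :: "real \<Rightarrow> real"
  assumes "continuous_on {0..pi} f" and "\<And>\<theta>. \<theta> \<in> {0..pi} \<Longrightarrow> f \<theta> \<ge> 0" and "f (pi / 2) > 0"
  shows "integral {0..pi} f > 0"
proof -
  have "pi / 2 \<in> {0..pi}" by simp
  then have "integral {0..pi} f \<noteq> 0"
    using integral_eq_0_iff[OF assms(1) pi_gt_zero assms(2)] assms(3) by force
  moreover have "integral {0..pi} f \<ge> 0"
    by (intro integral_nonneg integrable_continuous_interval assms) auto
  ultimately show ?thesis by simp
qed

definition sin_mass :: "nat \<Rightarrow> real" where
  "sin_mass k = integral {0..pi} (\<lambda>\<theta>. sin \<theta> ^ (k - 1))"

lemma sin_mass_pos: "sin_mass k > 0"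
  unfolding sin_mass_def
  by (rule integral_0_pi_pos) (auto intro!: continuous_intros zero_le_power sin_ge_zero)

lemma pw_0 [simp]: "pw a 0 \<theta> = 1"
  by (simp add: pw_def horo_def)

lemma psi_0: "psi k a 0 = of_real (sin_mass k)"
  unfolding psi_def sin_mass_def
  by (subst integral_linear[OF _ bounded_linear_of_real, unfolded o_def, symmetric])
    (auto intro!: integrable_continuous_interval continuous_intros)

text \<open>At \<open>r = 0\<close> all powers equal 1, and the integration by parts with
  \<open>a = 0\<close> says that \<open>cos \<theta> * sin \<theta> ^ (k - 1)\<close> has integral
  0.\<close>

lemma psi1_0:
  assumes "k \<ge> 1" shows "psi1 k a 0 = 0"
proof -
  have "integral {0..pi} (\<lambda>\<theta>. of_nat k * (of_real (cos \<theta>) * complex_of_real (sin \<theta> ^ (k - 1)))) = 0"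
    using integral_pw_by_parts[OF assms, of 0 0] by (simp add: mult.assoc)
  then have "integral {0..pi} (\<lambda>\<theta>. of_real (cos \<theta>) * complex_of_real (sin \<theta> ^ (k - 1))) = 0"
    using assms by simp
  then show ?thesis by (simp add: psi1_def mult.assoc)
qed

section \<open>Transfer to the ball model and identification of the eigenfunctions\<close>

lemma twice_cont_diff_on_cong:
  assumes "f twice_cont_diff_on S" and "\<And>x. x \<in> S \<Longrightarrow> g x = f x"
  shows "g twice_cont_diff_on S"
proof -
  have "(g has_derivative D) (at x within S)" if "(f has_derivative D) (at x within S)" "x \<in> S" for D x
    using has_derivative_transform[OF that(2) assms(2) that(1)] .
  with assms(1) show ?thesis unfolding twice_cont_diff_on_def by fast
qed

text \<open>The scaled distance is \<open>u (norm x)\<close> with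
  \<open>u t = 2 * artanh (t / \<rho>)\<close>, smooth through \<open>t = 0\<close>. The composite
  with \<open>\<Phi>\<close> is thus defined for negative \<open>t\<close> too, and
  \<open>\<Phi>' 0 = 0\<close> makes its derivative vanish at 0, as the radial criterion
  requires.\<close>

lemma twice_cont_diff_on_hyp_dist:
  fixes \<Phi> \<Phi>' \<Phi>'' :: "real \<Rightarrow> 'b::real_normed_vector"
  assumes D1: "\<And>r. (\<Phi> has_vector_derivative \<Phi>' r) (at r)"
    and D2: "\<And>r. (\<Phi>' has_vector_derivative \<Phi>'' r) (at r)"
    and cont: "continuous_on UNIV \<Phi>''" and "\<Phi>' 0 = 0" and \<rho>: "\<rho> > 0"
  shows "(\<lambda>x::'a::euclidean_space. \<Phi> (hyp_dist \<rho> 0 x / \<rho>)) twice_cont_diff_on ball 0 \<rho>"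
proof -
  define u where "u = (\<lambda>t. 2 * artanh (t / \<rho>))"
  define u1 where "u1 = (\<lambda>t. 2 * \<rho> / (\<rho>\<^sup>2 - t\<^sup>2))"
  define u2 where "u2 = (\<lambda>t. 4 * \<rho> * t / (\<rho>\<^sup>2 - t\<^sup>2)\<^sup>2)"
  have pos: "\<rho>\<^sup>2 - t\<^sup>2 > 0" if "\<bar>t\<bar> < \<rho>" for t
    using that abs_le_square_iff[of \<rho> t] by (auto simp: not_le[symmetric])
  have u: "(u has_real_derivative u1 t) (at t)" if t: "\<bar>t\<bar> < \<rho>" for t
  proof -
    have "\<bar>t / \<rho>\<bar> < 1" using t \<rho> by (simp add: abs_divide)
    then have "((\<lambda>t. artanh (t / \<rho>)) has_real_derivative 1 / (1 - (t / \<rho>)\<^sup>2) * (1 / \<rho>)) (at t)"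
      using \<rho> by (intro DERIV_chain2[OF artanh_real_has_field_derivative]) (auto intro!: derivative_eq_intros)
    then have "(u has_real_derivative 2 * (1 / (1 - (t / \<rho>)\<^sup>2) * (1 / \<rho>))) (at t)"
      unfolding u_def by (rule DERIV_cmult)
    moreover have "1 - (t / \<rho>)\<^sup>2 = (\<rho>\<^sup>2 - t\<^sup>2) / \<rho>\<^sup>2" using \<rho> by (simp add: field_simps)
    ultimately show ?thesis using \<rho> by (simp add: u1_def power2_eq_square)
  qed
  have u1: "(u1 has_real_derivative u2 t) (at t)" if t: "\<bar>t\<bar> < \<rho>" for t
    unfolding u1_def u2_def using pos[OF t] by (auto intro!: derivative_eq_intros simp: power2_eq_square)
  have u0: "u 0 = 0" by (simp add: u_def)
  have comp: "((\<lambda>t. f (u t)) has_vector_derivative u1 t *\<^sub>R f1 (u t)) (at t)"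
    if "\<And>r. (f has_vector_derivative f1 r) (at r)" and "\<bar>t\<bar> < \<rho>" for f f1 :: "real \<Rightarrow> 'b" and t
    using vector_diff_chain_at[OF u[OF that(2), unfolded has_real_derivative_iff_has_vector_derivative] that(1)]
    by (simp add: o_def)
  have "(\<lambda>x::'a. \<Phi> (u (norm x))) twice_cont_diff_on ball 0 \<rho>"
  proof (rule radial_twice_cont_diff_on_ball[where E = "\<lambda>t. \<Phi> (u t)"
        and E' = "\<lambda>t. u1 t *\<^sub>R \<Phi>' (u t)"
        and E'' = "\<lambda>t. u1 t *\<^sub>R u1 t *\<^sub>R \<Phi>'' (u t) + u2 t *\<^sub>R \<Phi>' (u t)"])
    fix t :: real assume t: "\<bar>t\<bar> < \<rho>"
    show "((\<lambda>t. \<Phi> (u t)) has_vector_derivative u1 t *\<^sub>R \<Phi>' (u t)) (at t)"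
      by (rule comp[OF D1 t])
    show "((\<lambda>t. u1 t *\<^sub>R \<Phi>' (u t)) has_vector_derivative u1 t *\<^sub>R u1 t *\<^sub>R \<Phi>'' (u t) + u2 t *\<^sub>R \<Phi>' (u t)) (at t)"
      by (rule has_vector_derivative_scaleR[OF u1[OF t] comp[OF D2 t]])
    have \<Phi>_cont: "isCont \<Phi>'' r" "isCont \<Phi>' r" for r
      using cont D2 by (auto simp: continuous_on_eq_continuous_at intro: has_vector_derivative_continuous)
    have [simp]: "isCont (\<lambda>t. \<Phi>'' (u t)) t" "isCont (\<lambda>t. \<Phi>' (u t)) t"
      using isCont_o2[OF DERIV_isCont[OF u[OF t]] \<Phi>_cont(1)]
        isCont_o2[OF DERIV_isCont[OF u[OF t]] \<Phi>_cont(2)] by auto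
    have [simp]: "isCont u1 t" "isCont u2 t"
      using pos[OF t] unfolding u1_def u2_def by (intro continuous_intros; simp)+
    show "isCont (\<lambda>t. u1 t *\<^sub>R u1 t *\<^sub>R \<Phi>'' (u t) + u2 t *\<^sub>R \<Phi>' (u t)) t"
      by (intro isCont_add isCont_scaleR) simp_all
  qed (simp_all add: assms(4) u0 \<rho>)
  then show ?thesis
    by (rule twice_cont_diff_on_cong) (use \<rho> in \<open>simp add: hyp_dist_0 u_def\<close>)
qed

text \<open>Replacing \<open>r\<close> by \<open>r / \<rho>\<close> turns the curvature -1 equation
  with parameter \<open>a * (k + a)\<close> into the required one; the condition on \<open>a\<close>
  matches the eigenvalues.\<close>

lemma radial_eigenfunction_psi:
  assumes k: "k \<ge> 1" and \<rho>: "\<rho> > 0" and a: "a * (of_nat k + a) = - (of_real \<rho>)\<^sup>2 * \<mu>"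
  shows "radial_eigenfunction TYPE('a::euclidean_space) k \<rho> \<mu>
    (restrict (\<lambda>r. psi k a (r / \<rho>) / of_real (sin_mass k)) {0..})"
proof -
  define N where "N = complex_of_real (sin_mass k)"
  let ?f = "\<lambda>r. psi k a (r / \<rho>) / N"
  let ?f1 = "\<lambda>r. (1 / \<rho>) *\<^sub>R psi1 k a (r / \<rho>) / N"
  let ?f2 = "\<lambda>r. (1 / \<rho>) *\<^sub>R ((1 / \<rho>) *\<^sub>R psi2 k a (r / \<rho>)) / N"
  let ?g = "restrict ?f {0..}"
  have scale: "((\<lambda>r. h (r / \<rho>)) has_vector_derivative (1 / \<rho>) *\<^sub>R h1 (r / \<rho>)) (at r)"
    if "\<And>r. (h has_vector_derivative h1 r) (at r)" for h h1 :: "real \<Rightarrow> complex" and r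
  proof -
    have "((\<lambda>r. r / \<rho>) has_vector_derivative 1 / \<rho>) (at r)"
      using \<rho> by (auto intro!: derivative_eq_intros simp flip: has_real_derivative_iff_has_vector_derivative)
    from vector_diff_chain_at[OF this that] show ?thesis by (simp add: o_def)
  qed
  have C2: "(\<lambda>x::'a. ?f (hyp_dist \<rho> 0 x)) twice_cont_diff_on ball 0 \<rho>"
    by (rule twice_cont_diff_on_hyp_dist[where \<Phi> = "\<lambda>r. psi k a r / N" and \<Phi>' = "\<lambda>r. psi1 k a r / N"
          and \<Phi>'' = "\<lambda>r. psi2 k a r / N"])
      (auto intro!: has_vector_derivative_divide has_vector_derivative_psi has_vector_derivative_psi1
        continuous_intros continuous_on_psi2 simp: psi1_0[OF k] \<rho> N_def sin_mass_pos[THEN less_imp_neq, symmetric])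
  have dist_nonneg: "hyp_dist \<rho> 0 x \<ge> 0" if "x \<in> ball 0 \<rho>" for x :: 'a
  proof -
    have "norm x / \<rho> < 1" using that \<rho> by simp
    then have "0 \<le> artanh (norm x / \<rho>)" using \<rho> by (simp add: artanh_def)
    then show ?thesis using that \<rho> by (simp add: hyp_dist_0)
  qed
  have "(\<lambda>x::'a. ?g (hyp_dist \<rho> 0 x)) twice_cont_diff_on ball 0 \<rho>"
    by (rule twice_cont_diff_on_cong[OF C2]) (simp add: dist_nonneg)
  moreover have "(?g has_vector_derivative ?f1 r) (at r) \<and> (?f1 has_vector_derivative ?f2 r) (at r) \<and>
      ?f2 r + of_real (real k / \<rho> * (cosh (r / \<rho>) / sinh (r / \<rho>))) * ?f1 r + \<mu> * ?g r = 0"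
    if r: "r > 0" for r
  proof (intro conjI)
    have "(?f has_vector_derivative ?f1 r) (at r)"
      by (intro has_vector_derivative_divide scale has_vector_derivative_psi)
    then show "(?g has_vector_derivative ?f1 r) (at r)"
      by (rule has_vector_derivative_transform_within_open[where S = "{0<..}"]) (use r in auto)
    show "(?f1 has_vector_derivative ?f2 r) (at r)"
      by (intro has_vector_derivative_divide bounded_linear.has_vector_derivative[OF bounded_linear_scaleR_right]
          scale has_vector_derivative_psi1)
    define x where "x = r / \<rho>"
    have "x \<noteq> 0" using r \<rho> by (simp add: x_def)
    from psi_ode[OF k this, of a]
    have "psi2 k a x + of_real (real k * (cosh x / sinh x)) * psi1 k a x + (of_real \<rho>)\<^sup>2 * \<mu> * psi k a x = 0"
      by (simp add: a)
    then have eq: "(psi2 k a x + of_real (real k * (cosh x / sinh x)) * psi1 k a x + (of_real \<rho>)\<^sup>2 * \<mu> * psi k a x)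
        / (N * (of_real \<rho>)\<^sup>2) = 0" by simp
    have "?f2 r + of_real (real k / \<rho> * (cosh x / sinh x)) * ?f1 r + \<mu> * ?g r =
      (psi2 k a x + of_real (real k * (cosh x / sinh x)) * psi1 k a x + (of_real \<rho>)\<^sup>2 * \<mu> * psi k a x)
        / (N * (of_real \<rho>)\<^sup>2)"
      using \<rho> r sin_mass_pos[of k] unfolding x_def[symmetric]
      by (simp add: scaleR_conv_of_real N_def power2_eq_square add_divide_distrib x_def mult_ac)
    also note eq
    finally show "?f2 r + of_real (real k / \<rho> * (cosh (r / \<rho>) / sinh (r / \<rho>))) * ?f1 r + \<mu> * ?g r = 0"
      unfolding x_def .
  qed
  then have "\<exists>f1 f2. \<forall>r>0. (?g has_vector_derivative f1 r) (at r) \<and> (f1 has_vector_derivative f2 r) (at r) \<and>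
      f2 r + of_real (real k / \<rho> * (cosh (r / \<rho>) / sinh (r / \<rho>))) * f1 r + \<mu> * ?g r = 0"
    by (intro exI[of _ ?f1] exI[of _ ?f2]) simp
  ultimately show ?thesis
    unfolding radial_eigenfunction_def N_def[symmetric] by (intro conjI restrict_extensional)
qed

text \<open>Existence through \<open>psi\<close> and uniqueness through the energy estimate together
  resolve the definite description in \<open>phi\<close>.\<close>

lemma phi_eq_psi:
  assumes k: "k \<ge> 1" and \<rho>: "\<rho> > 0" and a: "a * (of_nat k + a) = - (of_real \<rho>)\<^sup>2 * \<mu>"
  shows "phi TYPE('a::euclidean_space) k \<rho> \<mu> = restrict (\<lambda>r. psi k a (r / \<rho>) / of_real (sin_mass k)) {0..}"
    (is "_ = ?g")
  unfolding phi_def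
proof (rule the_equality)
  have g0: "?g 0 = 1" using sin_mass_pos[of k] by (simp add: psi_0)
  with radial_eigenfunction_psi[OF assms]
  show "radial_eigenfunction TYPE('a) k \<rho> \<mu> ?g \<and> ?g 0 = 1" by blast
  show "f = ?g" if "radial_eigenfunction TYPE('a) k \<rho> \<mu> f \<and> f 0 = 1" for f
    using radial_eigenfunction_unique[OF _ radial_eigenfunction_psi[OF assms, where 'a='a] _ \<rho>] that g0 by metis
qed

section \<open>The cosine transform in the spectral parameter\<close>

text \<open>What remains of the integrand of \<open>psi\<close> when the exponent is
  \<open>-k/2 + is\<close> or \<open>-k/2 - is\<close> and the factor depending on \<open>s\<close>
  is split off; it is the density of the positive measure.\<close>

definition wt :: "nat \<Rightarrow> real \<Rightarrow> real \<Rightarrow> real" where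
  "wt k R \<theta> = exp (- (real k / 2) * ln (horo R \<theta>)) * sin \<theta> ^ (k - 1)"

definition sph :: "nat \<Rightarrow> real \<Rightarrow> complex \<Rightarrow> complex" where
  "sph k R s = integral {0..pi} (\<lambda>\<theta>. cos (s * of_real (ln (horo R \<theta>))) * of_real (wt k R \<theta>))"

lemma continuous_on_ln_horo [continuous_intros]:
  fixes A :: "'a::t2_space set"
  shows "continuous_on A f \<Longrightarrow> continuous_on A g \<Longrightarrow> continuous_on A (\<lambda>x. ln (horo (f x) (g x)))"
  using horo_pos by (intro continuous_intros) (auto simp: less_imp_neq[symmetric])

lemma continuous_on_wt [continuous_intros]:
  fixes A :: "'a::t2_space set"
  shows "continuous_on A f \<Longrightarrow> continuous_on A g \<Longrightarrow> continuous_on A (\<lambda>x. wt k (f x) (g x))"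
  unfolding wt_def by (intro continuous_intros)

lemma wt_nonneg: "\<theta> \<in> {0..pi} \<Longrightarrow> wt k R \<theta> \<ge> 0"
  by (simp add: wt_def sin_ge_zero)

lemma wt_pos: "wt k R (pi / 2) > 0"
  by (simp add: wt_def)

text \<open>It confines the measure to the interval from \<open>-R\<close> to \<open>R\<close>; both
  the width of the strip of injectivity and the exponential type in \<open>s\<close> come from
  this.\<close>

lemma abs_ln_horo_le: "\<bar>ln (horo R \<theta>)\<bar> \<le> \<bar>R\<bar>"
proof -
  have "exp (- \<bar>R\<bar>) \<le> exp (ln (horo R \<theta>))" "exp (ln (horo R \<theta>)) \<le> exp \<bar>R\<bar>"
    using horo_ge[of R \<theta>] horo_le[of R \<theta>] horo_pos[of R \<theta>] by simp_all
  then show ?thesis unfolding exp_le_cancel_iff by linarith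
qed

text \<open>The exponents \<open>-k/2 + is\<close> and \<open>-k/2 - is\<close> belong to the same eigenvalue, so by uniqueness the two
  integrals agree; their average is a cosine transform of a positive measure.\<close>

lemma phi_eq_sph:
  assumes k: "k \<ge> 1" and \<rho>: "\<rho> > 0" and s: "s\<^sup>2 = (of_real \<rho>)\<^sup>2 * \<mu> - of_real ((real k)\<^sup>2 / 4)"
    and r: "r \<ge> 0"
  shows "phi TYPE('a::euclidean_space) k \<rho> \<mu> r = sph k (r / \<rho>) s / of_real (sin_mass k)"
proof -
  let ?a = "\<lambda>s. - of_nat k / 2 + \<i> * s"
  let ?R = "r / \<rho>"
  have a: "?a t * (of_nat k + ?a t) = - (of_real \<rho>)\<^sup>2 * \<mu>" if "t\<^sup>2 = s\<^sup>2" for t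
  proof -
    have "?a t * (of_nat k + ?a t) = - (t\<^sup>2 + of_real ((real k)\<^sup>2 / 4))"
      by (simp add: power2_eq_square field_simps)
    then show ?thesis using s that by simp
  qed
  have eq: "phi TYPE('a) k \<rho> \<mu> r = psi k (?a t) ?R / of_real (sin_mass k)" if "t\<^sup>2 = s\<^sup>2" for t
    using phi_eq_psi[OF k \<rho> a[OF that], where 'a='a] r by simp
  have "sph k ?R s = integral {0..pi} (\<lambda>\<theta>. (pw (?a s) ?R \<theta> * of_real (sin \<theta> ^ (k - 1)) +
      pw (?a (- s)) ?R \<theta> * of_real (sin \<theta> ^ (k - 1))) / 2)"
    unfolding sph_def
  proof (rule integral_cong)
    fix \<theta>
    define l where "l = complex_of_real (ln (horo ?R \<theta>))"
    have "cos (s * l) * exp (- (of_nat k / 2) * l) = (exp (?a s * l) + exp (?a (- s) * l)) / 2"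
      by (simp add: cos_exp_eq add_divide_distrib algebra_simps flip: exp_add)
    then show "cos (s * of_real (ln (horo ?R \<theta>))) * of_real (wt k ?R \<theta>) =
      (pw (?a s) ?R \<theta> * of_real (sin \<theta> ^ (k - 1)) + pw (?a (- s)) ?R \<theta> * of_real (sin \<theta> ^ (k - 1))) / 2"
      unfolding pw_def l_def wt_def of_real_mult exp_of_real[symmetric]
      by (simp add: mult.assoc[symmetric] flip: distrib_right)
  qed
  also have "\<dots> = (psi k (?a s) ?R + psi k (?a (- s)) ?R) / 2"
    unfolding psi_def integral_divide
    by (subst integral_add[symmetric]) (auto intro!: integrable_continuous_interval continuous_intros)
  finally show ?thesis using eq[of s] eq[of "- s"] sin_mass_pos[of k] by simp
qed

subsection \<open>Injectivity on the strip\<close>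

lemma sph_even: "sph k R (- s) = sph k R s"
  by (simp add: sph_def)

lemma Re_mult_of_real: "Re (z * of_real c) = Re z * c"
  by simp

text \<open>One rotation \<open>e\<close> serves all angles at once. As the weight is nonnegative,
  and positive at \<open>pi / 2\<close>, the rotated difference of the integrals has negative real
  part and cannot be 0.\<close>

lemma sph_neq:
  assumes le: "\<And>\<theta>. Re ((cos (s * of_real (ln (horo R \<theta>))) - cos (t * of_real (ln (horo R \<theta>)))) * e) \<le> 0"
    and less: "Re ((cos (s * of_real (ln (horo R (pi / 2)))) - cos (t * of_real (ln (horo R (pi / 2))))) * e) < 0"
  shows "sph k R s \<noteq> sph k R t"
proof
  assume eq: "sph k R s = sph k R t"
  let ?d = "\<lambda>\<theta>. (cos (s * of_real (ln (horo R \<theta>))) - cos (t * of_real (ln (horo R \<theta>)))) * e"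
  let ?f = "\<lambda>s \<theta>. cos (s * of_real (ln (horo R \<theta>))) * complex_of_real (wt k R \<theta>)"
  have int: "?f s integrable_on {0..pi}" "?f t integrable_on {0..pi}"
    by (intro integrable_continuous_interval continuous_intros)+
  have "((\<lambda>\<theta>. (?f s \<theta> - ?f t \<theta>) * e) has_integral (sph k R s - sph k R t) * e) {0..pi}"
    unfolding sph_def by (intro has_integral_mult_left has_integral_diff integrable_integral int)
  then have "((\<lambda>\<theta>. Re ((?f s \<theta> - ?f t \<theta>) * e)) has_integral Re ((sph k R s - sph k R t) * e)) {0..pi}"
    by (rule has_integral_Re)
  moreover have "Re ((?f s \<theta> - ?f t \<theta>) * e) = Re (?d \<theta>) * wt k R \<theta>" for \<theta>
  proof -
    have "(?f s \<theta> - ?f t \<theta>) * e = ?d \<theta> * of_real (wt k R \<theta>)" by (simp add: algebra_simps)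
    then show ?thesis by (simp only: Re_mult_of_real)
  qed
  ultimately have "((\<lambda>\<theta>. Re (?d \<theta>) * wt k R \<theta>) has_integral 0) {0..pi}" by (simp add: eq)
  from integral_unique[OF has_integral_neg[OF this]]
  have "integral {0..pi} (\<lambda>\<theta>. - (Re (?d \<theta>) * wt k R \<theta>)) = 0" by (simp only: minus_zero)
  moreover have "integral {0..pi} (\<lambda>\<theta>. - (Re (?d \<theta>) * wt k R \<theta>)) > 0"
    using le less wt_nonneg wt_pos
    by (intro integral_0_pi_pos continuous_intros) (auto simp: mult_nonpos_nonneg mult_neg_pos simp del: times_complex.sel)
  ultimately show False by simp
qed

text \<open>Noshiro--Warschawski argument: on the half strip the derivative \<open>-x sin(x w)\<close> of \<open>cos(x w)\<close> has
  negative real part, and the half strip is convex.\<close>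

lemma Re_cos_diff_strip:
  fixes s t :: complex and x :: real
  assumes "x > 0" "0 \<le> Re s" "0 \<le> Re t" "Re s + Re t > 0" "Re s * x \<le> pi / 2" "Re t * x \<le> pi / 2" "s \<noteq> t"
  shows "Re ((cos (s * of_real x) - cos (t * of_real x)) * cnj (s - t)) < 0"
proof -
  \<comment> \<open>The segment from \<open>t\<close> at \<open>u = 0\<close> to \<open>s\<close> at
    \<open>u = 1\<close>, scaled by \<open>x\<close>. The factor \<open>cnj (s - t)\<close> cancels
    the phase of the velocity, leaving a real multiple of \<open>sin (z u)\<close> in the
    derivative.\<close>
  define z where "z = (\<lambda>u::real. (t + of_real u * (s - t)) * of_real x)"
  define g where "g = (\<lambda>u. Re (cos (z u) * cnj (s - t)))"
  have der: "(g has_real_derivative - (x * (norm (s - t))\<^sup>2 * Re (sin (z u)))) (at u)" for u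
  proof -
    define d where "d = cnj (s - t)"
    have "((\<lambda>w. cos ((t + w * (s - t)) * of_real x) * d) has_field_derivative
        - sin (z u) * ((s - t) * of_real x) * d) (at (of_real u))"
      unfolding z_def by (auto intro!: derivative_eq_intros)
    then have "((\<lambda>u. cos (z u) * d) has_vector_derivative
        - sin (z u) * ((s - t) * of_real x) * d) (at u)"
      unfolding z_def by (rule has_vector_derivative_real_field)
    then have "(g has_vector_derivative Re (- sin (z u) * ((s - t) * of_real x) * d)) (at u)"
      unfolding g_def d_def[symmetric] by (rule bounded_linear.has_vector_derivative[OF bounded_linear_Re])
    moreover have "- sin (z u) * ((s - t) * of_real x) * d = - sin (z u) * of_real (x * (norm (s - t))\<^sup>2)"
      unfolding d_def of_real_mult complex_norm_square by (simp only: mult_ac)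
    ultimately have "(g has_vector_derivative Re (- sin (z u) * of_real (x * (norm (s - t))\<^sup>2))) (at u)"
      by (simp only:)
    then show ?thesis
      unfolding Re_mult_of_real has_real_derivative_iff_has_vector_derivative by (simp add: mult.commute)
  qed
  \<comment> \<open>Only interior \<open>u\<close> are tested: an endpoint may lie on the imaginary
    axis, where the real part of the sine vanishes. Inside, \<open>Re (z u)\<close> is positive and
    at most \<open>pi / 2\<close>.\<close>
  have "g 1 < g 0"
  proof (rule DERIV_neg_imp_decreasing_open[where f = g and a = 0 and b = 1])
    fix u :: real assume u: "0 < u" "u < 1"
    have "Re (z u) = (1 - u) * (Re t * x) + u * (Re s * x)" by (simp add: z_def algebra_simps)
    moreover have "(1 - u) * (Re t * x) + u * (Re s * x) \<le> pi / 2"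
      using u assms by (intro convex_bound_le) auto
    moreover have "(1 - u) * (Re t * x) + u * (Re s * x) > 0"
    proof (cases "Re t = 0")
      case True
      then show ?thesis using u assms by simp
    next
      case False
      then show ?thesis using u assms by (intro add_pos_nonneg mult_pos_pos mult_nonneg_nonneg) auto
    qed
    ultimately have "sin (Re (z u)) > 0" using pi_gt_zero by (intro sin_gt_zero) linarith+
    then have "Re (sin (z u)) > 0" by (simp add: Re_sin add_pos_pos)
    then have "- (x * (norm (s - t))\<^sup>2 * Re (sin (z u))) < 0" using assms by simp
    with der show "\<exists>y. (g has_real_derivative y) (at u) \<and> y < 0" by blast
  next
    show "continuous_on {0..1} g"
      by (rule DERIV_atLeastAtMost_imp_continuous_on) (use der in blast)
  qed simp
  then show ?thesis by (simp add: g_def z_def left_diff_distrib)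
qed

lemma cos_i_times: "cos (\<i> * of_real y) = of_real (cosh y)"
  by (simp add: cos_exp_eq cosh_def scaleR_conv_of_real exp_of_real exp_minus)

text \<open>Here the cosine becomes \<open>cosh (b * l)\<close>, which increases strictly with the
  modulus of \<open>b\<close> unless \<open>l = 0\<close>; at angle \<open>pi / 2\<close> one has
  \<open>l = ln (cosh R) > 0\<close>.\<close>

lemma sph_inj_imaginary:
  assumes "R \<noteq> 0" "\<bar>b\<bar> < \<bar>c\<bar>"
  shows "sph k R (\<i> * of_real b) \<noteq> sph k R (\<i> * of_real c)"
proof (rule sph_neq[where e = 1])
  have eq: "Re ((cos (\<i> * of_real b * of_real l) - cos (\<i> * of_real c * of_real l)) * 1) = cosh \<bar>b * l\<bar> - cosh \<bar>c * l\<bar>" for l :: real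
    using cos_i_times[of "b * l"] cos_i_times[of "c * l"] by (simp add: mult.assoc)
  show "Re ((cos (\<i> * of_real b * of_real (ln (horo R \<theta>))) - cos (\<i> * of_real c * of_real (ln (horo R \<theta>)))) * 1) \<le> 0" for \<theta>
    unfolding eq using assms by (simp add: cosh_real_nonneg_le_iff abs_mult mult_right_mono del: cosh_real_abs)
  have "ln (cosh R) > 0" using cosh_real_ge_1[of R] cosh_real_one_iff[of R] assms(1) by (intro ln_gt_zero) linarith
  then have less: "\<bar>b * ln (cosh R)\<bar> < \<bar>c * ln (cosh R)\<bar>" using assms(2) by (simp add: abs_mult)
  show "Re ((cos (\<i> * of_real b * of_real (ln (horo R (pi / 2)))) - cos (\<i> * of_real c * of_real (ln (horo R (pi / 2))))) * 1) < 0"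
    unfolding eq using less by (simp add: cosh_real_nonneg_less_iff horo_def del: cosh_real_abs)
qed

text \<open>If both parameters are imaginary, monotonicity of \<open>cosh\<close> decides. Otherwise
  \<open>cnj (s - t)\<close> is a common rotation for all angles: since cosine is even,
  \<open>l\<close> may be replaced by its modulus, which is at most \<open>R\<close>.\<close>

lemma sph_inj_strip:
  assumes R: "R > 0" and s: "0 \<le> Re s" "Re s * R \<le> pi / 2" and t: "0 \<le> Re t" "Re t * R \<le> pi / 2"
    and eq: "sph k R s = sph k R t"
  shows "s\<^sup>2 = t\<^sup>2"
proof (cases "Re s + Re t > 0")
  case False
  then have "Re s = 0" "Re t = 0" using s t by auto
  then have st: "s = \<i> * of_real (Im s)" "t = \<i> * of_real (Im t)" by (auto simp: complex_eq_iff)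
  have "\<not> \<bar>Im s\<bar> < \<bar>Im t\<bar>" "\<not> \<bar>Im t\<bar> < \<bar>Im s\<bar>"
    using sph_inj_imaginary[of R "Im s" "Im t" k] sph_inj_imaginary[of R "Im t" "Im s" k] R eq st by auto
  then have "(Im s)\<^sup>2 = (Im t)\<^sup>2" by (intro power2_eq_iff[THEN iffD2]) linarith
  then show ?thesis by (subst st(1), subst st(2)) (simp add: power_mult_distrib flip: of_real_power)
next
  case True
  show ?thesis
  proof (rule ccontr)
    assume "s\<^sup>2 \<noteq> t\<^sup>2"
    then have st: "s \<noteq> t" by auto
    have abs: "cos (w * of_real l) = cos (w * of_real \<bar>l\<bar>)" for w :: complex and l :: real
      by (simp add: abs_if)
    have neg: "Re ((cos (s * of_real l) - cos (t * of_real l)) * cnj (s - t)) < 0"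
      if "l \<noteq> 0" "\<bar>l\<bar> \<le> R" for l
    proof -
      have "Re s * \<bar>l\<bar> \<le> Re s * R" "Re t * \<bar>l\<bar> \<le> Re t * R"
        using that s t by (auto intro: mult_left_mono)
      then show ?thesis
        unfolding abs[of _ l] using that s t True st by (intro Re_cos_diff_strip) auto
    qed
    have le: "\<bar>ln (horo R \<theta>)\<bar> \<le> R" for \<theta> using abs_ln_horo_le[of R \<theta>] R by simp
    have "sph k R s \<noteq> sph k R t"
    proof (rule sph_neq[where e = "cnj (s - t)"])
      show "Re ((cos (s * of_real (ln (horo R \<theta>))) - cos (t * of_real (ln (horo R \<theta>)))) * cnj (s - t)) \<le> 0" for \<theta>
        using neg[OF _ le[of \<theta>]] by (cases "ln (horo R \<theta>) = 0") (auto intro: less_imp_le simp del: ln_eq_zero_iff)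
      have "cosh R > 1" using cosh_real_ge_1[of R] cosh_real_one_iff[of R] R by linarith
      then have "ln (horo R (pi / 2)) \<noteq> 0" using R by (simp add: horo_def)
      then show "Re ((cos (s * of_real (ln (horo R (pi / 2)))) - cos (t * of_real (ln (horo R (pi / 2))))) * cnj (s - t)) < 0"
        by (rule neg[OF _ le])
    qed
    then show False using eq by simp
  qed
qed

subsection \<open>Entire functions of exponential type\<close>

text \<open>The map sending \<open>w\<close> to \<open>w / (2M - w)\<close> takes the half plane
  \<open>Re w < M\<close> into the unit disc and fixes 0. The Schwarz lemma at modulus at most 1/2
  gives \<open>2 * norm (g z) \<le> 2 * M + norm (g z)\<close>.\<close>

lemma Borel_Caratheodory_half:
  fixes g :: "complex \<Rightarrow> complex"
  assumes hol: "g holomorphic_on UNIV" and g0: "g 0 = 0" and M: "M > 0"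
    and le: "\<And>z. norm z < r \<Longrightarrow> Re (g z) < M" and z: "norm z \<le> r / 2" and r: "r > 0"
  shows "norm (g z) \<le> 2 * M"
proof -
  define h where "h = (\<lambda>z. g (of_real r * z) / (2 * of_real M - g (of_real r * z)))"
  have lt: "norm (g (of_real r * z)) < norm (2 * of_real M - g (of_real r * z))" 
    and nz: "2 * of_real M - g (of_real r * z) \<noteq> 0" if "norm z < 1" for z
  proof -
    let ?w = "g (of_real r * z)"
    have "Re ?w < M"
      using that r by (intro le) (simp add: norm_mult)
    then have "(norm ?w)\<^sup>2 < (norm (2 * of_real M - ?w))\<^sup>2"
      using M unfolding cmod_power2
      by (simp add: power2_eq_square algebra_simps)
    then show lt: "norm ?w < norm (2 * of_real M - ?w)"
      by (meson norm_ge_zero power2_less_imp_less)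
    then show "2 * of_real M - ?w \<noteq> 0" by (smt (verit) norm_eq_zero norm_ge_zero)
  qed
  have h_hol: "h holomorphic_on ball 0 1"
    unfolding h_def using nz
    by (intro holomorphic_intros holomorphic_on_compose_gen[OF _ hol, unfolded o_def]) auto
  have "norm (h z) < 1" if "norm z < 1" for z
    using lt[OF that] by (simp add: h_def norm_divide divide_simps)
  then have Schwarz: "norm (h z) \<le> norm z" if "norm z < 1" for z
    using Schwarz_Lemma(1)[OF h_hol _ _ that] by (simp add: h_def g0)
  define u where "u = z / of_real r"
  have u: "norm u \<le> 1 / 2" using z r by (simp add: u_def norm_divide divide_simps)
  have gz: "of_real r * u = z" using r by (simp add: u_def)
  have "norm (h u) \<le> 1 / 2" using Schwarz[of u] u by simp
  then have "norm (g z) \<le> 1 / 2 * norm (2 * of_real M - g z)"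
    using nz[of u] u unfolding h_def gz norm_divide
    by (simp add: pos_divide_le_eq)
  also have "norm (2 * of_real M - g z) \<le> 2 * M + norm (g z)"
    using M norm_triangle_ineq4[of "2 * of_real M" "g z"] by (simp add: norm_mult)
  finally show ?thesis by simp
qed

text \<open>Borel-Caratheodory upgrades the one-sided bound on the real part to linear growth of the
  modulus, and Liouville's theorem for polynomial growth leaves degree at most 1.\<close>

lemma entire_Re_linear_bound_imp_affine:
  fixes g :: "complex \<Rightarrow> complex"
  assumes hol: "g holomorphic_on UNIV" and le: "\<And>z. Re (g z) \<le> A + B * norm z"
  shows "\<exists>a b. \<forall>z. g z = a + b * z"
proof -
  define C where "C = \<bar>A\<bar> + \<bar>B\<bar> + norm (g 0) + 1"
  have "norm (g z - g 0) \<le> 6 * C * norm z ^ 1" if z: "1 \<le> norm z" for z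
  proof -
    let ?M = "3 * C * norm z"
    have C: "C > 0" by (simp add: C_def add_nonneg_pos)
    \<comment> \<open>The radius \<open>2 * norm z\<close> puts \<open>z\<close> into the half-size
      disc. The summand 1 in \<open>C\<close> makes the bound on the real part strict.\<close>
    have "norm (g z - g 0) \<le> 2 * ?M"
    proof (rule Borel_Caratheodory_half[where g = "\<lambda>z. g z - g 0" and r = "2 * norm z"])
      show "(\<lambda>z. g z - g 0) holomorphic_on UNIV" by (intro holomorphic_intros hol)
      show "0 < ?M" using C z by (intro mult_pos_pos) auto
      fix w :: complex assume w: "norm w < 2 * norm z"
      have "Re (g w - g 0) \<le> A + B * norm w + norm (g 0)"
        using le[of w] abs_Re_le_cmod[of "g 0"] by simp
      also have "\<dots> \<le> \<bar>A\<bar> + \<bar>B\<bar> * (2 * norm z) + norm (g 0)"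
      proof -
        have "B * norm w \<le> \<bar>B\<bar> * (2 * norm z)"
          using w by (intro mult_mono) auto
        then show ?thesis by linarith
      qed
      also have "\<dots> \<le> \<bar>A\<bar> * norm z + \<bar>B\<bar> * (2 * norm z) + norm (g 0) * norm z"
        using z by (intro add_mono order.refl) (auto simp: mult_le_cancel_left1)
      also have "\<dots> < ?M"
      proof -
        have "0 \<le> \<bar>A\<bar> * norm z" "0 \<le> \<bar>B\<bar> * norm z" "0 \<le> norm (g 0) * norm z" "0 < norm z" using z by auto
        then show ?thesis unfolding C_def distrib_left distrib_right mult.assoc by linarith
      qed
      finally show "Re (g w - g 0) < ?M" .
    qed (use z in auto)
    then show ?thesis by simp
  qed
  then have expand: "g z - g 0 = (\<Sum>k\<le>1. (deriv ^^ k) (\<lambda>z. g z - g 0) 0 / fact k * z ^ k)" for z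
    by (intro Liouville_polynomial holomorphic_intros hol) auto
  have "g z = g 0 + deriv (\<lambda>z. g z - g 0) 0 * z" for z
    using expand[of z] by (simp add: diff_eq_eq add.commute)
  then show ?thesis by blast
qed

text \<open>Induction on the number of distinct zeros. A function without zeros is
  \<open>exp g\<close> with the real part of \<open>g\<close> bounded linearly, so \<open>g\<close>
  is affine; otherwise one zero is divided out with its full multiplicity, which preserves
  exponential type.\<close>

lemma exponential_type_finite_zeros:
  fixes f :: "complex \<Rightarrow> complex"
  assumes "f holomorphic_on UNIV" and "\<And>z. norm (f z) \<le> exp (A + B * norm z)"
    and "finite {z. f z = 0}" 
  shows "\<exists>p b. \<forall>z. f z = poly p z * exp (b * z)"
  using assms
proof (induction "card {z. f z = 0}" arbitrary: f A B)
  case 0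
  then have nz: "f z \<noteq> 0" for z by (auto simp: card_eq_0_iff)
  from holomorphic_logarithm_exists[OF convex_UNIV open_UNIV 0(2)] nz
  obtain g where g: "g holomorphic_on UNIV" "\<And>z. exp (g z) = f z" by (metis UNIV_I)
  have "exp (Re (g z)) \<le> exp (A + B * norm z)" for z
    using 0(3)[of z] by (simp flip: g(2))
  then obtain a b where "\<And>z. g z = a + b * z"
    using entire_Re_linear_bound_imp_affine[OF g(1), of A B] by auto
  then have "f z = poly [:exp a:] z * exp (b * z)" for z
    by (simp flip: g(2) add: exp_add)
  then show ?case by blast
next
  case (Suc n)
  then obtain a where a: "f a = 0" by (metis (mono_tags) card_eq_0_iff empty_Collect_eq nat.distinct(1))
  have "\<not> f constant_on UNIV"
  proof
    assume "f constant_on UNIV"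
    then have "f z = 0" for z using a by (auto simp: constant_on_def)
    then show False using Suc.prems(3) infinite_UNIV_char_0[where 'a=complex] by simp
  qed
  then obtain g0 r m where g0: "0 < m" "0 < r" "g0 holomorphic_on ball a r"
      "\<And>w. w \<in> ball a r \<Longrightarrow> f w = (w - a)^m * g0 w" "\<And>w. w \<in> ball a r \<Longrightarrow> g0 w \<noteq> 0"
    using holomorphic_factor_zero_nonconstant[OF Suc.prems(1) open_UNIV connected_UNIV UNIV_I a]
    by (metis )
  \<comment> \<open>The value at \<open>a\<close> is the one given by the local factorisation; it
    removes the singularity and is nonzero, so the zero at \<open>a\<close> disappears.\<close>
  define g where "g = (\<lambda>z. if z = a then g0 a else f z / (z - a)^m)"
  have fg: "f z = (z - a)^m * g z" for z
    using a g0(1) by (simp add: g_def)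
  have "g holomorphic_on ball a r"
    by (rule holomorphic_transform[OF g0(3)]) (use g0(4) in \<open>auto simp: g_def\<close>)
  moreover have "g holomorphic_on UNIV - {a}"
    by (rule holomorphic_transform[of "\<lambda>z. f z / (z - a)^m"])
      (auto simp: g_def intro!: holomorphic_intros holomorphic_on_subset[OF Suc.prems(1)])
  ultimately have "g holomorphic_on ball a r \<union> (UNIV - {a})"
    by (intro holomorphic_on_Un) auto
  moreover have "ball a r \<union> (UNIV - {a}) = UNIV" using g0(2) by auto
  ultimately have g_hol: "g holomorphic_on UNIV" by simp
  have ga: "g a \<noteq> 0" using g0(2,5) by (simp add: g_def)
  have zeros: "{z. g z = 0} = {z. f z = 0} - {a}"
    using ga g0(1) by (auto simp: fg)
  have card: "n = card {z. g z = 0}"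
    using Suc.hyps(2) Suc.prems(3) a by (simp add: zeros)
  have "compact (g ` cball a 1)"
    by (intro compact_continuous_image holomorphic_on_imp_continuous_on
        holomorphic_on_subset[OF g_hol]) auto
  then obtain K where K: "\<And>z. z \<in> cball a 1 \<Longrightarrow> norm (g z) \<le> K" 
    by (meson compact_imp_bounded bounded_iff imageI)
  \<comment> \<open>One constant for two regions: near \<open>a\<close>,
    \<open>norm (g z) \<le> 1 + A' \<le> exp A'\<close> by compactness; at distance more than 1 from
    \<open>a\<close>, dividing by \<open>(z - a)^m\<close> does not enlarge the modulus.\<close>
  define A' where "A' = \<bar>A\<bar> + \<bar>K\<bar>"
  have bound: "norm (g z) \<le> exp (A' + \<bar>B\<bar> * norm z)" for z
  proof (cases "z \<in> cball a 1")
    case True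
    have "norm (g z) \<le> 1 + A'" using K[OF True] by (simp add: A'_def)
    also have "\<dots> \<le> exp A'" by (rule exp_ge_add_one_self)
    also have "\<dots> \<le> exp (A' + \<bar>B\<bar> * norm z)" by simp
    finally show ?thesis .
  next
    case False
    then have "1 \<le> norm ((z - a)^m)"
      by (simp add: dist_norm norm_minus_commute norm_power)
    then have "norm (g z) \<le> norm (f z)"
      unfolding fg[of z] norm_mult by (simp add: mult_le_cancel_right1)
    also have "\<dots> \<le> exp (A + B * norm z)" by (rule Suc.prems)
    also have "\<dots> \<le> exp (A' + \<bar>B\<bar> * norm z)"
    proof -
      have "B * norm z \<le> \<bar>B\<bar> * norm z" by (intro mult_right_mono) auto
      then show ?thesis by (simp add: A'_def)
    qed
    finally show ?thesis .
  qed
  from Suc.hyps(1)[OF card g_hol bound] Suc.prems(3) zeros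
  obtain p b where "\<And>z. g z = poly p z * exp (b * z)" by auto
  then have "f z = poly ([:-a, 1:]^m * p) z * exp (b * z)" for z
    by (simp add: fg poly_power)
  then show ?case by blast
qed

text \<open>If \<open>f = F - c\<close> had finitely many zeros, then \<open>f(z) = p(z) e\<^bsup>bz\<^esup>\<close>; evenness cancels the exponentials in
  \<open>f(z)\<^sup>2 = f(z) f(-z)\<close>, which is therefore a polynomial bounded on the real axis.\<close>

lemma even_exponential_type_infinite_preimage:
  fixes F :: "complex \<Rightarrow> complex"
  assumes hol: "F holomorphic_on UNIV" and even: "\<And>z. F (- z) = F z"
    and type: "\<And>z. norm (F z) \<le> exp (B * norm z)" and B: "B \<ge> 0"
    and bdd: "\<And>x :: real. norm (F (of_real x)) \<le> 1"
    and nonconst: "\<not> F constant_on UNIV"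
  shows "infinite {z. F z = c}"
proof
  define f where "f = (\<lambda>z. F z - c)"
  assume "finite {z. F z = c}"
  then have fin: "finite {z. f z = 0}" by (simp add: f_def)
  have f_hol: "f holomorphic_on UNIV" unfolding f_def by (intro holomorphic_intros hol)
  have "norm (f z) \<le> exp (norm c + B * norm z)" for z
  proof -
    have "norm (f z) \<le> exp (B * norm z) + norm c"
      using norm_triangle_ineq4[of "F z" c] type[of z] by (simp add: f_def)
    also have "norm c \<le> norm c * exp (B * norm z)"
      using B by (simp add: mult_le_cancel_left1)
    also have "exp (B * norm z) + norm c * exp (B * norm z) = (1 + norm c) * exp (B * norm z)"
      by (simp add: algebra_simps)
    also have "\<dots> \<le> exp (norm c) * exp (B * norm z)"
      by (intro mult_right_mono exp_ge_add_one_self) auto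
    finally show ?thesis by (simp add: exp_add)
  qed
  then obtain p b where p: "\<And>z. f z = poly p z * exp (b * z)"
    using exponential_type_finite_zeros[OF f_hol _ fin] by blast
  define q where "q = p * pcompose p [:0, -1:]"
  have sq: "f z ^ 2 = poly q z" for z
  proof -
    have "f z ^ 2 = f z * f (- z)" by (simp add: f_def even power2_eq_square)
    also have "\<dots> = poly q z" by (simp add: p q_def poly_pcompose flip: exp_minus)
      (simp add: exp_minus field_simps)
    finally show ?thesis .
  qed
  have "degree q = 0"
  proof (rule ccontr)
    assume "degree q \<noteq> 0"
    then obtain a q' where q': "q = pCons a q'" "q' \<noteq> 0" by (cases q) (auto split: if_splits)
    \<comment> \<open>The threshold exceeds \<open>(1 + norm c)^2\<close>, which bounds
      \<open>f^2\<close> in modulus on the real axis, so a nonconstant \<open>q\<close> is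
      impossible.\<close>
    obtain r where r: "\<And>z. r \<le> norm z \<Longrightarrow> (2 + norm c)^2 \<le> norm (poly (pCons a q') z)"
      using poly_infinity[OF q'(2)] by blast
    have "(2 + norm c)^2 \<le> norm (f (of_real \<bar>r\<bar>)) ^ 2"
      using r[of "of_real \<bar>r\<bar>"] by (simp flip: q'(1) sq add: norm_power)
    moreover have "norm (f (of_real \<bar>r\<bar>)) \<le> 1 + norm c"
      using norm_triangle_ineq4[of "F (of_real \<bar>r\<bar>)" c] bdd[of "\<bar>r\<bar>"] by (simp add: f_def)
    then have "norm (f (of_real \<bar>r\<bar>)) ^ 2 \<le> (1 + norm c) ^ 2"
      by (intro power_mono) auto
    moreover have "(1 + norm c)^2 < (2 + norm c)^2" by (intro power_strict_mono) auto
    ultimately show False by linarith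
  qed
  then obtain d where "\<And>z. f z ^ 2 = d" by (metis sq degree_eq_zeroE poly_const_conv)
  \<comment> \<open>A continuous function on the connected plane with values among two square roots
    is constant.\<close>
  then have "f ` UNIV \<subseteq> {csqrt d, - csqrt d}"
    by (auto simp: ) (metis power2_csqrt power2_eq_iff)
  then have "f constant_on UNIV"
    by (intro continuous_finite_range_constant holomorphic_on_imp_continuous_on f_hol)
      (auto intro: finite_subset)
  then have "F constant_on UNIV"
    unfolding constant_on_def f_def by (metis diff_add_cancel)
  then show False using nonconst by blast
qed

subsection \<open>Eigenfunctions with a prescribed value\<close>

definition wt_mass :: "nat \<Rightarrow> real \<Rightarrow> real" where
  "wt_mass k R = integral {0..pi} (wt k R)"

lemma wt_mass_pos: "wt_mass k R > 0"
  unfolding wt_mass_def by (intro integral_0_pi_pos continuous_intros wt_nonneg wt_pos)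

lemma norm_sph_le:
  assumes "\<And>l. \<bar>l\<bar> \<le> \<bar>R\<bar> \<Longrightarrow> norm (cos (s * of_real l)) \<le> B"
  shows "norm (sph k R s) \<le> B * wt_mass k R"
proof -
  have "norm (sph k R s) \<le> integral {0..pi} (\<lambda>\<theta>. B * wt k R \<theta>)"
    unfolding sph_def
  proof (rule integral_norm_bound_integral)
    fix \<theta> assume "\<theta> \<in> {0..pi}"
    then show "norm (cos (s * of_real (ln (horo R \<theta>))) * of_real (wt k R \<theta>)) \<le> B * wt k R \<theta>"
      using assms[OF abs_ln_horo_le[of R \<theta>]] wt_nonneg[of \<theta> k R] by (simp add: norm_mult mult_right_mono)
  qed (intro integrable_continuous_interval continuous_intros)+
  then show ?thesis by (simp add: wt_mass_def)
qed

lemma norm_cos_le_exp: "norm (cos z) \<le> exp (norm (z::complex))"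
proof -
  have "norm (cos z) \<le> (norm (exp (\<i> * z)) + norm (exp (- (\<i> * z)))) / 2"
    unfolding cos_exp_eq norm_divide by (simp add: norm_triangle_ineq divide_right_mono del: norm_exp_eq_Re)
  also have "\<dots> \<le> (exp (norm z) + exp (norm z)) / 2"
    using abs_Im_le_cmod[of z] by (intro divide_right_mono add_mono) auto
  finally show ?thesis by simp
qed

lemma sph_holomorphic: "sph k R holomorphic_on UNIV"
proof -
  have "(\<lambda>s. integral (cbox 0 pi) (\<lambda>\<theta>. cos (s * of_real (ln (horo R \<theta>))) * of_real (wt k R \<theta>))) holomorphic_on UNIV"
  proof (rule leibniz_rule_holomorphic)
    show "((\<lambda>s. cos (s * of_real (ln (horo R \<theta>))) * of_real (wt k R \<theta>)) has_field_derivative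
      - sin (s * of_real (ln (horo R \<theta>))) * of_real (ln (horo R \<theta>)) * of_real (wt k R \<theta>)) (at s within UNIV)" for s \<theta>
      by (auto intro!: derivative_eq_intros)
    show "continuous_on (UNIV \<times> cbox 0 pi) (\<lambda>(s, \<theta>). - sin (s * of_real (ln (horo R \<theta>))) * of_real (ln (horo R \<theta>)) * complex_of_real (wt k R \<theta>))"
      unfolding case_prod_unfold by (intro continuous_intros)
  qed (auto intro!: integrable_continuous_interval continuous_intros)
  then show ?thesis by (simp add: sph_def[abs_def])
qed

text \<open>After division by the total mass of the measure the function has modulus at most 1 on
  the real axis and exponential type at most \<open>R\<close>, so the result on even entire
  functions applies.\<close>

lemma sph_infinite_preimage:
  assumes R: "R > 0"
  shows "infinite {s. sph k R s = c}"
proof -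
  define M where "M = complex_of_real (wt_mass k R)"
  have M: "M \<noteq> 0" "norm M = wt_mass k R" using wt_mass_pos[of k R] by (auto simp: M_def)
  let ?F = "\<lambda>s. sph k R s / M"
  have le: "norm (?F s) \<le> B" if "\<And>l. \<bar>l\<bar> \<le> \<bar>R\<bar> \<Longrightarrow> norm (cos (s * of_real l)) \<le> B" for s B
    using norm_sph_le[of R s B k] that M wt_mass_pos[of k R] by (simp add: norm_divide divide_le_eq)
  have "infinite {s. ?F s = c / M}"
  proof (rule even_exponential_type_infinite_preimage)
    show "?F holomorphic_on UNIV" by (intro holomorphic_intros sph_holomorphic M)
    show "?F (- s) = ?F s" for s by (simp add: sph_even)
    show "norm (?F s) \<le> exp (R * norm s)" for s
    proof (rule le)
      fix l assume "\<bar>l\<bar> \<le> \<bar>R\<bar>"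
      have "norm (cos (s * of_real l)) \<le> exp (norm s * \<bar>l\<bar>)"
        using norm_cos_le_exp[of "s * of_real l"] by (simp add: norm_mult)
      also have "\<dots> \<le> exp (R * norm s)"
        using \<open>\<bar>l\<bar> \<le> \<bar>R\<bar>\<close> R by (simp add: mult.commute mult_right_mono)
      finally show "norm (cos (s * of_real l)) \<le> exp (R * norm s)" .
    qed
    show "norm (?F (of_real x)) \<le> 1" for x :: real
      by (rule le) (simp only: of_real_mult[symmetric] cos_of_real norm_of_real abs_cos_le_one)
    show "\<not> ?F constant_on UNIV"
    proof
      assume "?F constant_on UNIV"
      \<comment> \<open>Both 0 and \<open>pi / (2 * R)\<close> lie in the closed strip of
        injectivity, the latter on its edge, and their squares differ.\<close>
      then have "?F 0 = ?F (of_real (pi / (2 * R)))" unfolding constant_on_def by fastforce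
      then have "sph k R 0 = sph k R (of_real (pi / (2 * R)))" using M by simp
      then have "0\<^sup>2 = (complex_of_real (pi / (2 * R)))\<^sup>2"
        using R by (intro sph_inj_strip[of R]) auto
      then show False using R by simp
    qed
  qed (use R in auto)
  then show ?thesis using M by simp
qed

section \<open>From the spectral parameter back to eigenvalues\<close>

text \<open>The square of the spectral parameter \<open>s\<close> belonging to \<open>\<mu>\<close>.
  Its root \<open>csqrt\<close> has nonnegative real part, so it represents the pair of parameters
  \<open>s\<close>, \<open>-s\<close> in the right half plane.\<close>

definition spectral :: "nat \<Rightarrow> real \<Rightarrow> complex \<Rightarrow> complex" where
  "spectral k \<rho> \<mu> = (of_real \<rho>)\<^sup>2 * \<mu> - of_real ((real k)\<^sup>2 / 4)"

lemma spectral_inj: "\<rho> > 0 \<Longrightarrow> spectral k \<rho> \<mu> = spectral k \<rho> \<nu> \<Longrightarrow> \<mu> = \<nu>"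
  by (simp add: spectral_def)

lemma phi_eq_sph_csqrt:
  assumes "k \<ge> 1" "\<rho> > 0" "r \<ge> 0"
  shows "phi TYPE('a::euclidean_space) k \<rho> \<mu> r = sph k (r / \<rho>) (csqrt (spectral k \<rho> \<mu>)) / of_real (sin_mass k)"
  by (rule phi_eq_sph) (use assms in \<open>auto simp: spectral_def\<close>)

lemma phi_eq_imp_eigenvalue_eq:
  assumes k: "k \<ge> 1" and \<rho>: "\<rho> > 0" and r: "r > 0"
    and \<mu>: "Re (csqrt (spectral k \<rho> \<mu>)) * (r / \<rho>) \<le> pi / 2"
    and \<nu>: "Re (csqrt (spectral k \<rho> \<nu>)) * (r / \<rho>) \<le> pi / 2"
    and eq: "phi TYPE('a::euclidean_space) k \<rho> \<mu> r = phi TYPE('a) k \<rho> \<nu> r"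
  shows "\<mu> = \<nu>"
proof -
  have "sph k (r / \<rho>) (csqrt (spectral k \<rho> \<mu>)) = sph k (r / \<rho>) (csqrt (spectral k \<rho> \<nu>))"
    using eq r sin_mass_pos[of k] by (simp add: phi_eq_sph_csqrt[OF k \<rho>])
  then have "(csqrt (spectral k \<rho> \<mu>))\<^sup>2 = (csqrt (spectral k \<rho> \<nu>))\<^sup>2"
    using r \<rho> \<mu> \<nu> by (intro sph_inj_strip[of "r / \<rho>"] Re_csqrt) auto
  then show ?thesis using spectral_inj[OF \<rho>] by simp
qed

text \<open>Equality of the whole functions leaves the radius free: \<open>R\<close> is chosen so
  small that both parameters lie in the strip of injectivity. This allows membership of
  \<open>phi\<close> in \<open>Omega\<close> to be read as a condition on the eigenvalue
  itself.\<close>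

lemma phi_inj:
  assumes k: "k \<ge> 1" and \<rho>: "\<rho> > 0"
    and eq: "phi TYPE('a::euclidean_space) k \<rho> \<mu> = phi TYPE('a) k \<rho> \<nu>"
  shows "\<mu> = \<nu>"
proof -
  define a b where "a = Re (csqrt (spectral k \<rho> \<mu>))" and "b = Re (csqrt (spectral k \<rho> \<nu>))"
  have ab: "a \<ge> 0" "b \<ge> 0" unfolding a_def b_def by (rule Re_csqrt)+
  define R where "R = pi / 2 / (1 + a + b)"
  have "R > 0" using ab by (simp add: R_def)
  moreover have "a * R \<le> pi / 2" "b * R \<le> pi / 2"
    using ab by (simp_all add: R_def divide_le_eq distrib_left mult.commute)
  ultimately show ?thesis
    using \<rho> eq by (intro phi_eq_imp_eigenvalue_eq[OF k \<rho>, where r = "\<rho> * R" and 'a='a, of \<mu> \<nu>])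
      (simp_all add: a_def b_def)
qed

lemma phi_0:
  assumes "k \<ge> 1" "\<rho> > 0"
  shows "phi TYPE('a::euclidean_space) k \<rho> \<mu> 0 = 1"
proof -
  have "sph k 0 s = of_real (sin_mass k)" for s
    using psi_0[of k 0] by (simp add: sph_def wt_def horo_def psi_def)
  then show ?thesis using phi_eq_sph_csqrt[OF assms, of 0, where 'a='a] sin_mass_pos[of k] by simp
qed

text \<open>Writing \<open>spectral k \<rho> \<mu>\<close> as the square of \<open>a + ib\<close>
  and clearing denominators, the parabolic inequality factors as
  \<open>(a^2 - p^2) * (p^2 + b^2) \<le> 0\<close>, which bounds \<open>a\<close> by
  \<open>p\<close>.\<close>

lemma Omega_strip:
  assumes k: "k \<ge> 1" and \<rho>: "\<rho> > 0" and p: "p > 0"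
    and "phi TYPE('a::euclidean_space) k \<rho> \<mu> \<in> Omega TYPE('a) k \<rho> p"
  shows "Re (csqrt (spectral k \<rho> \<mu>)) \<le> p"
proof -
  define \<kappa> where "\<kappa> = - 1 / \<rho>\<^sup>2"
  have reg: "Re \<mu> \<le> - \<kappa> * (p\<^sup>2 + (real k)\<^sup>2 / 4) + (Im \<mu>)\<^sup>2 / (4 * \<kappa> * p\<^sup>2)"
    using assms(4) phi_inj[OF k \<rho>, where 'a='a] unfolding Omega_def Let_def \<kappa>_def by blast
  define a b where "a = Re (csqrt (spectral k \<rho> \<mu>))" and "b = Im (csqrt (spectral k \<rho> \<mu>))"
  have "csqrt (spectral k \<rho> \<mu>) = Complex a b" by (simp only: a_def b_def complex.collapse)
  then have sq: "spectral k \<rho> \<mu> = (Complex a b)\<^sup>2" by (metis power2_csqrt)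
  have Re: "\<rho>\<^sup>2 * Re \<mu> = a\<^sup>2 - b\<^sup>2 + (real k)\<^sup>2 / 4" and Im: "\<rho>\<^sup>2 * Im \<mu> = 2 * a * b"
    using arg_cong[OF sq, of Re] arg_cong[OF sq, of Im]
    by (simp_all add: spectral_def power2_eq_square)
  have "\<rho>\<^sup>2 * Re \<mu> \<le> \<rho>\<^sup>2 * (- \<kappa> * (p\<^sup>2 + (real k)\<^sup>2 / 4) + (Im \<mu>)\<^sup>2 / (4 * \<kappa> * p\<^sup>2))"
    using reg by (intro mult_left_mono) auto
  also have "\<dots> = p\<^sup>2 + (real k)\<^sup>2 / 4 - (\<rho>\<^sup>2 * Im \<mu>)\<^sup>2 / (4 * p\<^sup>2)"
    using \<rho> p by (simp add: \<kappa>_def field_simps power2_eq_square)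
  finally have "a\<^sup>2 - b\<^sup>2 + a\<^sup>2 * b\<^sup>2 / p\<^sup>2 \<le> p\<^sup>2"
    unfolding Re Im by (simp add: power_mult_distrib)
  then have "(a\<^sup>2 - b\<^sup>2 + a\<^sup>2 * b\<^sup>2 / p\<^sup>2) * p\<^sup>2 \<le> p\<^sup>2 * p\<^sup>2"
    by (intro mult_right_mono) auto
  then have "(a\<^sup>2 - p\<^sup>2) * (p\<^sup>2 + b\<^sup>2) \<le> 0"
    using p by (simp add: algebra_simps)
  moreover have "p\<^sup>2 + b\<^sup>2 > 0" using p by (simp add: add_pos_nonneg)
  ultimately have "a\<^sup>2 \<le> p\<^sup>2" by (simp add: mult_le_0_iff)
  then show ?thesis using p power2_le_imp_le[of a p] by (simp add: a_def)
qed

theorem corollary3p5: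
  fixes k :: nat and \<rho> p r\<^sub>0 :: real
  assumes "k \<ge> 1" and "DIM('a::euclidean_space) = k + 1"
    and "\<rho> > 0" and "p > 0"
    and "r\<^sub>0 \<in> {0<..pi * \<rho> / (2 * p)}"
  defines "\<phi> \<equiv> phi TYPE('a) k \<rho>" and "\<Omega> \<equiv> Omega TYPE('a) k \<rho> p"
  shows "(\<forall>\<mu> \<mu>'. \<phi> \<mu> \<in> \<Omega> \<and> \<phi> \<mu>' \<in> \<Omega> \<and> \<phi> \<mu> r\<^sub>0 = \<phi> \<mu>' r\<^sub>0 \<longrightarrow>
            \<mu> = \<mu>' \<and> (\<forall>r\<ge>0. \<phi> \<mu> r = \<phi> \<mu>' r)) \<and>
         (\<forall>\<mu>. \<phi> \<mu> \<in> \<Omega> \<longrightarrow>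
            infinite {\<psi>. \<exists>\<nu>. \<psi> = \<phi> \<nu> \<and> \<phi> \<nu> 0 = 1 \<and> \<phi> \<nu> \<notin> \<Omega> \<and> \<phi> \<nu> r\<^sub>0 = \<phi> \<mu> r\<^sub>0})"
proof -
  note k = assms(1) and \<rho> = assms(3) and p = assms(4)
  have r0: "r\<^sub>0 > 0" and "r\<^sub>0 \<le> pi * \<rho> / (2 * p)" using assms(5) by auto
  then have pr: "p * (r\<^sub>0 / \<rho>) \<le> pi / 2" using \<rho> p by (simp add: field_simps)
  have strip: "Re (csqrt (spectral k \<rho> \<mu>)) * (r\<^sub>0 / \<rho>) \<le> pi / 2" if "\<phi> \<mu> \<in> \<Omega>" for \<mu>
  proof -
    have "Re (csqrt (spectral k \<rho> \<mu>)) * (r\<^sub>0 / \<rho>) \<le> p * (r\<^sub>0 / \<rho>)"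
      using Omega_strip[OF k \<rho> p, where 'a='a] that r0 \<rho> by (intro mult_right_mono) (auto simp: \<phi>_def \<Omega>_def)
    then show ?thesis using pr by linarith
  qed
  have inj: "\<mu> = \<nu>" if "\<phi> \<mu> \<in> \<Omega>" "\<phi> \<nu> \<in> \<Omega>" "\<phi> \<mu> r\<^sub>0 = \<phi> \<nu> r\<^sub>0" for \<mu> \<nu>
    using phi_eq_imp_eigenvalue_eq[OF k \<rho> r0 strip strip, where 'a='a] that by (simp add: \<phi>_def)
  have "infinite {\<psi>. \<exists>\<nu>. \<psi> = \<phi> \<nu> \<and> \<phi> \<nu> 0 = 1 \<and> \<phi> \<nu> \<notin> \<Omega> \<and> \<phi> \<nu> r\<^sub>0 = \<phi> \<mu> r\<^sub>0}"
    if \<mu>: "\<phi> \<mu> \<in> \<Omega>" for \<mu>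
  proof -
    define V where "V = {\<nu>. \<phi> \<nu> r\<^sub>0 = \<phi> \<mu> r\<^sub>0}"
    define c where "c = \<phi> \<mu> r\<^sub>0 * of_real (sin_mass k)"
    have "infinite V"
    proof
      assume "finite V"
      \<comment> \<open>Each eigenvalue accounts for at most the two parameters \<open>s\<close> and
        \<open>-s\<close>, so infinitely many solutions \<open>s\<close> need infinitely many
        eigenvalues.\<close>
      have "{s. sph k (r\<^sub>0 / \<rho>) s = c} \<subseteq> (\<Union>\<nu>\<in>V. {csqrt (spectral k \<rho> \<nu>), - csqrt (spectral k \<rho> \<nu>)})"
      proof
        fix s assume "s \<in> {s. sph k (r\<^sub>0 / \<rho>) s = c}"
        then have s: "sph k (r\<^sub>0 / \<rho>) s = c" by simp
        define \<nu> where "\<nu> = (s\<^sup>2 + of_real ((real k)\<^sup>2 / 4)) / (of_real \<rho>)\<^sup>2"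
        have \<nu>: "spectral k \<rho> \<nu> = s\<^sup>2" using \<rho> by (simp add: spectral_def \<nu>_def)
        then have "\<phi> \<nu> r\<^sub>0 = sph k (r\<^sub>0 / \<rho>) s / of_real (sin_mass k)"
          unfolding \<phi>_def using k \<rho> r0 by (intro phi_eq_sph) (auto simp: spectral_def)
        then have "\<nu> \<in> V" using s sin_mass_pos[of k] by (simp add: V_def c_def)
        moreover have "s = csqrt (spectral k \<rho> \<nu>) \<or> s = - csqrt (spectral k \<rho> \<nu>)"
          using \<nu> by (metis power2_csqrt power2_eq_iff)
        ultimately show "s \<in> (\<Union>\<nu>\<in>V. {csqrt (spectral k \<rho> \<nu>), - csqrt (spectral k \<rho> \<nu>)})" by blast
      qed
      moreover have "finite (\<Union>\<nu>\<in>V. {csqrt (spectral k \<rho> \<nu>), - csqrt (spectral k \<rho> \<nu>)})"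
        using \<open>finite V\<close> by simp
      ultimately have "finite {s. sph k (r\<^sub>0 / \<rho>) s = c}" by (rule finite_subset)
      then show False using sph_infinite_preimage[of "r\<^sub>0 / \<rho>" k c] r0 \<rho> by simp
    qed
    \<comment> \<open>By the first claim \<open>\<mu>\<close> is the only element of
      \<open>V\<close> whose eigenfunction lies in \<open>\<Omega>\<close>; once it is removed,
      injectivity turns infinitely many eigenvalues into infinitely many functions outside
      \<open>\<Omega>\<close>.\<close>
    moreover have "inj_on \<phi> (V - {\<mu>})"
      using phi_inj[OF k \<rho>, where 'a='a] by (auto simp: inj_on_def \<phi>_def)
    ultimately have "infinite (\<phi> ` (V - {\<mu>}))"
      by (simp add: finite_image_iff)
    moreover have "\<phi> ` (V - {\<mu>}) \<subseteq> {\<psi>. \<exists>\<nu>. \<psi> = \<phi> \<nu> \<and> \<phi> \<nu> 0 = 1 \<and> \<phi> \<nu> \<notin> \<Omega> \<and> \<phi> \<nu> r\<^sub>0 = \<phi> \<mu> r\<^sub>0}"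
      using inj[OF _ \<mu>] phi_0[OF k \<rho>, where 'a='a] by (auto simp: V_def \<phi>_def)
    ultimately show ?thesis using infinite_super by blast
  qed
  with inj show ?thesis by blast
qed

end
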